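(* Let $P$ be a finite poset of width $2$ and let $\kappa_2(P)$ denote the number of connected components of $\overline{G}(P)$ that have exactly $2$ vertices. Then $$|P|\cdot \overline{H}(P) \leqslant (2-\varepsilon)\log e(P) + \varepsilon\,\kappa_2(P), \qquad \text{where } \varepsilon = 2 - \frac{3\log 3 - 2}{\log 3}\ (\approx 0.26).$$
   Context: All logarithms are base $2$. For a finite simple graph $G=(V,E)$ with $n=|V|$ vertices, $\mathrm{STAB}(G)\subseteq\mathbb{R}^V$ is the convex hull of the characteristic vectors of the stable sets of $G$. The entropy of $G$ is $$H(G)=\min_{x\in \mathrm{STAB}(G),\,x>0} -\frac1n\sum_{v\in V}\log x_v.$$ For a finite poset $P$: - $\overline{G}(P)$ is its incomparability graph, whose vertices are the elements of $P$ and whose edges join distinct incomparable elements; - $\overline{H}(P):=H(\overline{G}(P))$; - $e(P)$ is the number of linear extensions of $P$; - the width of $P$ is the size of a largest antichain of $P$. *)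

theory Defs
  imports "HOL-Analysis.Analysis" "HOL-Library.Function_Algebras"
begin

text \<open>Pointwise vector space structure on functions, so that convex hulls in \<open>\<real>\<^sup>V\<close> are
  available for a vertex set \<open>V\<close> of arbitrary type.\<close>

instantiation "fun" :: (type, real_vector) real_vector
begin

definition scaleR_fun :: "real \<Rightarrow> ('a \<Rightarrow> 'b) \<Rightarrow> 'a \<Rightarrow> 'b"
  where "scaleR_fun c f = (\<lambda>x. c *\<^sub>R f x)"

instance
  by standard (auto simp: scaleR_fun_def fun_eq_iff plus_fun_def scaleR_add_right scaleR_add_left)

end

lemma scaleR_fun_apply [simp]: "(c *\<^sub>R f) x = c *\<^sub>R f x"
  for f :: "'a \<Rightarrow> 'b::real_vector"
  by (simp add: scaleR_fun_def)

lemma sum_fun_apply: "(\<Sum>i\<in>I. f i) x = (\<Sum>i\<in>I. f i x)"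
  for f :: "'i \<Rightarrow> 'a \<Rightarrow> 'b::comm_monoid_add"
  by (induction I rule: infinite_finite_induct) auto


section \<open>Graphs\<close>

text \<open>A graph is given by its vertex set \<open>V\<close> and its adjacency relation \<open>E\<close>, so each
  undirected edge \<open>uv\<close> is represented by both \<open>(u, v)\<close> and \<open>(v, u)\<close>.\<close>

definition finite_simple_graph :: "'a set \<Rightarrow> 'a rel \<Rightarrow> bool" where
  "finite_simple_graph V E \<longleftrightarrow> finite V \<and> E \<subseteq> V \<times> V \<and> sym E \<and> irrefl E"

definition stable_set :: "'a set \<Rightarrow> 'a rel \<Rightarrow> 'a set \<Rightarrow> bool" where
  "stable_set V E S \<longleftrightarrow> S \<subseteq> V \<and> (\<forall>u\<in>S. \<forall>v\<in>S. (u, v) \<notin> E)"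

text \<open>\<open>\<real>\<^sup>V\<close> is identified with the functions vanishing outside \<open>V\<close>.\<close>

definition STAB :: "'a set \<Rightarrow> 'a rel \<Rightarrow> ('a \<Rightarrow> real) set" where
  "STAB V E = convex hull (indicator ` {S. stable_set V E S})"

text \<open>The minimum over the positive points of \<open>STAB V E\<close>; it is attained for every finite simple
  graph, see \<open>graph_entropy_attained\<close> below.\<close>

definition graph_entropy :: "'a set \<Rightarrow> 'a rel \<Rightarrow> real" where
  "graph_entropy V E =
    (LEAST h. \<exists>x\<in>STAB V E. (\<forall>v\<in>V. x v > 0) \<and>
       h = - (1 / real (card V)) * (\<Sum>v\<in>V. log 2 (x v)))"

definition connected_components :: "'a set \<Rightarrow> 'a rel \<Rightarrow> 'a set set" where
  "connected_components V E = V // {(u, v). u \<in> V \<and> v \<in> V \<and> (u, v) \<in> E\<^sup>*}"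


section \<open>Posets\<close>

text \<open>A poset is given by its ground set \<open>A\<close> and a reflexive order relation \<open>r\<close> with
  \<open>partial_order_on A r\<close>.\<close>

definition incomparability :: "'a set \<Rightarrow> 'a rel \<Rightarrow> 'a rel" where
  "incomparability A r =
    {(u, v). u \<in> A \<and> v \<in> A \<and> u \<noteq> v \<and> (u, v) \<notin> r \<and> (v, u) \<notin> r}"

definition incomparability_entropy :: "'a set \<Rightarrow> 'a rel \<Rightarrow> real" where
  "incomparability_entropy A r = graph_entropy A (incomparability A r)"

definition linear_extensions :: "'a set \<Rightarrow> 'a rel \<Rightarrow> 'a rel set" where
  "linear_extensions A r = {s. linear_order_on A s \<and> r \<subseteq> s}"

definition antichain :: "'a set \<Rightarrow> 'a rel \<Rightarrow> 'a set \<Rightarrow> bool" where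
  "antichain A r S \<longleftrightarrow>
    S \<subseteq> A \<and> (\<forall>u\<in>S. \<forall>v\<in>S. u \<noteq> v \<longrightarrow> (u, v) \<notin> r \<and> (v, u) \<notin> r)"

definition width :: "'a set \<Rightarrow> 'a rel \<Rightarrow> nat" where
  "width A r = Max (card ` {S. antichain A r S})"

definition kappa2 :: "'a set \<Rightarrow> 'a rel \<Rightarrow> nat" where
  "kappa2 A r = card {C \<in> connected_components A (incomparability A r). card C = 2}"


section \<open>Well-definedness\<close>

lemma finite_simple_graph_incomparability:
  "finite A \<Longrightarrow> finite_simple_graph A (incomparability A r)"
  by (auto simp: finite_simple_graph_def incomparability_def sym_def irrefl_on_def)

lemma finite_linear_extensions: "finite A \<Longrightarrow> finite (linear_extensions A r)"
  by (rule finite_subset[of _ "Pow (A \<times> A)"])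
    (auto simp: linear_extensions_def order_on_defs)

lemma finite_antichains: "finite A \<Longrightarrow> finite {S. antichain A r S}"
  by (rule finite_subset[of _ "Pow A"]) (auto simp: antichain_def)

lemma finite_connected_components: "finite V \<Longrightarrow> finite (connected_components V E)"
  unfolding connected_components_def by (rule finite_quotient) auto

lemma finite_stable_sets: "finite V \<Longrightarrow> finite {S. stable_set V E S}"
  by (rule finite_subset[of _ "Pow V"]) (auto simp: stable_set_def)

lemma inj_indicator: "inj (indicator :: 'a set \<Rightarrow> 'a \<Rightarrow> real)"
  by (rule injI) (metis indicator_eq_1_iff set_eqI)

lemma STAB_eq:
  assumes "finite V"
  shows "STAB V E = {x. \<exists>u. (\<forall>S\<in>{S. stable_set V E S}. 0 \<le> u S) \<and> sum u {S. stable_set V E S} = 1 \<and>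
           x = (\<lambda>v. \<Sum>S | stable_set V E S. u S * indicator S v)}" (is "_ = ?R")
proof (intro equalityI subsetI)
  let ?T = "{S. stable_set V E S}"
  let ?I = "indicator :: 'a set \<Rightarrow> 'a \<Rightarrow> real"
  have fin: "finite ?T" using assms by (rule finite_stable_sets)
  have inj: "inj_on ?I ?T" using inj_indicator by (rule inj_on_subset) simp
  have hull: "STAB V E = {y. \<exists>u. (\<forall>x\<in>?I ` ?T. 0 \<le> u x) \<and> sum u (?I ` ?T) = 1 \<and>
      (\<Sum>x\<in>?I ` ?T. u x *\<^sub>R x) = y}"
    unfolding STAB_def by (rule convex_hull_finite) (use fin in simp)
  fix x
  {
    assume "x \<in> STAB V E"
    then obtain u where u: "\<forall>x\<in>?I ` ?T. 0 \<le> u x" "sum u (?I ` ?T) = 1"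
      "(\<Sum>x\<in>?I ` ?T. u x *\<^sub>R x) = x"
      unfolding hull by blast
    have "x = (\<lambda>v. \<Sum>S\<in>?T. u (?I S) * ?I S v)"
      using u(3) by (auto simp: fun_eq_iff sum.reindex[OF inj] sum_fun_apply)
    moreover have "sum (\<lambda>S. u (?I S)) ?T = 1"
      using u(2) by (simp add: sum.reindex[OF inj])
    ultimately show "x \<in> ?R"
      using u(1) by (intro CollectI exI[of _ "\<lambda>S. u (?I S)"]) auto
  next
    assume "x \<in> ?R"
    then obtain u where u: "\<forall>S\<in>?T. 0 \<le> u S" "sum u ?T = 1"
      "x = (\<lambda>v. \<Sum>S\<in>?T. u S * ?I S v)" by blast
    define w where "w = u \<circ> the_inv_into ?T ?I"
    have w: "w (?I S) = u S" if "S \<in> ?T" for S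
      using the_inv_into_f_f[OF inj that] by (simp add: w_def)
    have "sum w (?I ` ?T) = 1"
      using u(2) w by (simp add: sum.reindex[OF inj])
    moreover have "(\<Sum>y\<in>?I ` ?T. w y *\<^sub>R y) = x"
      using w by (auto simp: fun_eq_iff sum.reindex[OF inj] sum_fun_apply u(3) intro!: sum.cong)
    ultimately show "x \<in> STAB V E"
      unfolding hull using u(1) w by (intro CollectI exI[of _ w]) auto
  }
qed

lemma ex_pos_STAB:
  assumes "finite_simple_graph V E"
  shows "\<exists>x\<in>STAB V E. \<forall>v\<in>V. x v > 0"
proof -
  let ?T = "{S. stable_set V E S}"
  have fin: "finite V" using assms by (simp add: finite_simple_graph_def)
  then have finT: "finite ?T" by (rule finite_stable_sets)
  have "{} \<in> ?T" by (simp add: stable_set_def)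
  then have card: "real (card ?T) > 0" using finT by (auto simp: card_gt_0_iff)
  define u :: "'a set \<Rightarrow> real" where "u = (\<lambda>_. 1 / real (card ?T))"
  define x where "x = (\<lambda>v. \<Sum>S\<in>?T. u S * indicator S v)"
  have "x \<in> STAB V E"
    unfolding STAB_eq[OF fin] x_def
    using card by (intro CollectI exI[of _ u]) (auto simp: u_def)
  moreover have "x v > 0" if "v \<in> V" for v
  proof -
    have "{v} \<in> ?T"
      using assms that by (auto simp: stable_set_def finite_simple_graph_def irrefl_on_def)
    then have "u {v} * indicator {v} v \<le> x v"
      unfolding x_def using finT card by (intro member_le_sum) (auto simp: u_def)
    then show ?thesis using card by (auto simp: u_def intro: less_le_trans[rotated])
  qed
  ultimately show ?thesis by blast
qed

lemma graph_entropy_minimizer: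
  assumes "finite_simple_graph V E"
  shows "\<exists>x\<in>STAB V E. (\<forall>v\<in>V. x v > 0) \<and>
    (\<forall>y\<in>STAB V E. (\<forall>v\<in>V. y v > 0) \<longrightarrow>
      - (1 / real (card V)) * (\<Sum>v\<in>V. log 2 (x v)) \<le> - (1 / real (card V)) * (\<Sum>v\<in>V. log 2 (y v)))"
proof -
  let ?T = "{S. stable_set V E S}"
  have fin: "finite V" using assms by (simp add: finite_simple_graph_def)
  then have finT: "finite ?T" by (rule finite_stable_sets)
  define B :: "('a set \<Rightarrow> real) set"
    where "B = (\<Pi>\<^sub>E S\<in>UNIV. if S \<in> ?T then {0..1} else {0})"
  define K where "K = B \<inter> {u. sum u ?T = 1}"
  define pt :: "('a set \<Rightarrow> real) \<Rightarrow> 'a \<Rightarrow> real"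
    where "pt = (\<lambda>u v. \<Sum>S\<in>?T. u S * indicator S v)"
  have cont: "continuous_on UNIV (\<lambda>u :: 'a set \<Rightarrow> real. u S)" for S
    by (rule continuous_on_product_coordinates)
  have "compactin (product_topology (\<lambda>_::'a set. euclidean :: real topology) UNIV) B"
    unfolding B_def by (subst compactin_PiE) auto
  then have "compact B" by (simp add: euclidean_product_topology)
  moreover have "closed {u :: 'a set \<Rightarrow> real. sum u ?T = 1}"
    by (intro closed_Collect_eq continuous_on_sum cont continuous_on_const)
  ultimately have "compact K" unfolding K_def by (rule compact_Int_closed)
  have STAB_K: "STAB V E = pt ` K"
  proof (intro equalityI subsetI)
    fix x assume "x \<in> STAB V E"
    then obtain u where u: "\<forall>S\<in>?T. 0 \<le> u S" "sum u ?T = 1" "x = pt u"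
      unfolding STAB_eq[OF fin] pt_def by blast
    define w where "w = (\<lambda>S. if S \<in> ?T then u S else 0)"
    have "u S \<le> 1" if "S \<in> ?T" for S
      using member_le_sum[of S ?T u] that u finT by auto
    then have "w \<in> B" using u by (auto simp: B_def w_def)
    moreover have "sum w ?T = 1" using u(2) by (simp add: w_def)
    moreover have "pt w = x" by (auto simp: u(3) pt_def w_def fun_eq_iff intro!: sum.cong)
    ultimately show "x \<in> pt ` K" by (auto simp: K_def)
  next
    fix x assume "x \<in> pt ` K"
    then obtain u where u: "u \<in> B" "sum u ?T = 1" "x = pt u" by (auto simp: K_def)
    have "\<forall>S\<in>?T. 0 \<le> u S"
    proof
      fix S assume "S \<in> ?T"
      moreover have "u S \<in> (if S \<in> ?T then {0..1} else {0})"
        using u(1) unfolding B_def by (rule PiE_mem) simp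
      ultimately show "0 \<le> u S" by simp
    qed
    then show "x \<in> STAB V E" unfolding STAB_eq[OF fin] using u by (auto simp: pt_def)
  qed
  obtain x0 where x0: "x0 \<in> STAB V E" "\<forall>v\<in>V. x0 v > 0" using ex_pos_STAB[OF assms] by blast
  have "continuous_on UNIV (\<lambda>u. \<Prod>v\<in>V. pt u v)"
    unfolding pt_def
    by (intro continuous_on_prod continuous_on_sum continuous_on_mult cont continuous_on_const)
  then have "continuous_on K (\<lambda>u. \<Prod>v\<in>V. pt u v)" by (rule continuous_on_subset) simp
  moreover have "K \<noteq> {}" using x0 STAB_K by auto
  ultimately obtain u where u: "u \<in> K" "\<forall>w\<in>K. (\<Prod>v\<in>V. pt w v) \<le> (\<Prod>v\<in>V. pt u v)"
    using continuous_attains_sup[OF \<open>compact K\<close>] by blast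
  define x where "x = pt u"
  have x: "x \<in> STAB V E" using u by (simp add: x_def STAB_K)
  have max: "(\<Prod>v\<in>V. y v) \<le> (\<Prod>v\<in>V. x v)" if "y \<in> STAB V E" for y
    using that u unfolding STAB_K x_def by blast
  have nonneg: "x v \<ge> 0" for v
    using x unfolding STAB_eq[OF fin] by (auto intro!: sum_nonneg)
  have "0 < (\<Prod>v\<in>V. x0 v)" using x0 by (auto intro: prod_pos)
  then have prod_pos: "(\<Prod>v\<in>V. x v) > 0" using max[OF x0(1)] by linarith
  then have pos: "x v > 0" if "v \<in> V" for v
    using nonneg[of v] that fin by (metis less_eq_real_def less_irrefl prod_zero)
  have log_prod_eq: "log 2 (\<Prod>v\<in>V. y v) = (\<Sum>v\<in>V. log 2 (y v))"
    if "\<forall>v\<in>V. y v > 0" for y :: "'a \<Rightarrow> real"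
    using fin that by (subst log_def, subst ln_prod) (auto simp: log_def sum_divide_distrib)
  have "- (1 / real (card V)) * (\<Sum>v\<in>V. log 2 (x v)) \<le> - (1 / real (card V)) * (\<Sum>v\<in>V. log 2 (y v))"
    if y: "y \<in> STAB V E" "\<forall>v\<in>V. y v > 0" for y
  proof -
    have "(\<Prod>v\<in>V. y v) > 0" using y by (auto intro: Groups_Big.linordered_semidom_class.prod_pos)
    then have "log 2 (\<Prod>v\<in>V. y v) \<le> log 2 (\<Prod>v\<in>V. x v)" using max[OF y(1)] by simp
    then show ?thesis
      using pos y(2) log_prod_eq[of x] log_prod_eq[of y]
      by (intro mult_left_mono_neg) auto
  qed
  then show ?thesis using x pos by blast
qed

lemma graph_entropy_attained:
  assumes "finite_simple_graph V E"
  shows "\<exists>x\<in>STAB V E. (\<forall>v\<in>V. x v > 0) \<and>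
    graph_entropy V E = - (1 / real (card V)) * (\<Sum>v\<in>V. log 2 (x v))"
proof -
  obtain x where "x \<in> STAB V E" "\<forall>v\<in>V. x v > 0"
    "\<forall>y\<in>STAB V E. (\<forall>v\<in>V. y v > 0) \<longrightarrow>
      - (1 / real (card V)) * (\<Sum>v\<in>V. log 2 (x v)) \<le> - (1 / real (card V)) * (\<Sum>v\<in>V. log 2 (y v))"
    using graph_entropy_minimizer[OF assms] by blast
  moreover from this have "graph_entropy V E = - (1 / real (card V)) * (\<Sum>v\<in>V. log 2 (x v))"
    unfolding graph_entropy_def by (intro Least_equality) auto
  ultimately show ?thesis by blast
qed

lemma graph_entropy_le:
  assumes "finite_simple_graph V E" "y \<in> STAB V E" "\<forall>v\<in>V. y v > 0"
  shows "graph_entropy V E \<le> - (1 / real (card V)) * (\<Sum>v\<in>V. log 2 (y v))"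
proof -
  obtain x where x: "x \<in> STAB V E" "\<forall>v\<in>V. x v > 0"
    "\<forall>y\<in>STAB V E. (\<forall>v\<in>V. y v > 0) \<longrightarrow>
      - (1 / real (card V)) * (\<Sum>v\<in>V. log 2 (x v)) \<le> - (1 / real (card V)) * (\<Sum>v\<in>V. log 2 (y v))"
    using graph_entropy_minimizer[OF assms(1)] by blast
  from x have "graph_entropy V E = - (1 / real (card V)) * (\<Sum>v\<in>V. log 2 (x v))"
    unfolding graph_entropy_def by (intro Least_equality) auto
  with x assms show ?thesis by auto
qed

end

theory Submission
  imports Defs
begin

text \<open>Let \<open>x\<close> be the optimal point of \<open>STAB\<close> of the incomparability graph, let \<open>n\<close> be the number of
  elements of the poset and \<open>c = 2 - \<epsilon>\<close>. Optimality says that every chain has weight at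
  most \<open>n\<close> with respect to the weights \<open>1 / x v\<close>, with equality for the chains occurring in a
  convex representation of \<open>x\<close>. Placing each \<open>v\<close> as an interval of length \<open>1 / x v\<close> on top of the
  heaviest chain below it, the poset is laid out along the tape \<open>[0, n]\<close> such that comparable
  elements are disjoint and every point is covered either by one element with \<open>x = 1\<close> or by two
  elements whose \<open>x\<close>-values add up to \<open>1\<close>.

  The upper bound on the entropy uses not \<open>x\<close> itself but \<open>x\<close> rounded monotonically and
  symmetrically to the values \<open>1 / k\<close> and \<open>1 - 1 / k\<close>, which remains in \<open>STAB\<close> because the graph is
  bipartite. The number of linear extensions is bounded from below along the tape, from right to left:
  if \<open>a\<close> and \<open>b\<close> are present at the same time, there are at least as many extensions as those
  starting after the end of \<open>a\<close> and those starting after the end of \<open>b\<close> together. With \<open>\<beta> = 2 powr (1 / c)\<close>,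
  an element of rounded value \<open>1 / k\<close> with \<open>k \<ge> 3\<close> and the \<open>m \<in> {k - 1, k}\<close> elements ending beside it form a star
  contributing a factor \<open>m + 1\<close>; this is tight for \<open>k = 3\<close>, \<open>m = 2\<close> and determines \<open>c\<close>. Stretches of
  rounded value \<open>1 / 2\<close> have Fibonacci-like growth, which beats \<open>\<beta>\<close> per element except for a
  single pair. Such a pair is a component of the graph, accounted for by \<open>\<kappa>\<^sub>2\<close>, or it is incomparable to
  something in a neighbouring stretch, and the additional extensions make up for the loss.\<close>

section \<open>Counting linear extensions\<close>

definition ext_count :: "'a rel \<Rightarrow> 'a set \<Rightarrow> nat" where
  "ext_count r U = card (linear_extensions U (Restr r U))"

lemma ext_count_empty: "ext_count r {} = 1"
proof -
  have "linear_extensions {} (Restr r {}) = {{}}"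
    by (auto simp: linear_extensions_def order_on_defs refl_on_def antisym_def trans_def total_on_def)
  then show ?thesis by (simp add: ext_count_def)
qed

section \<open>Linear extensions that begin with a given minimal element\<close>

definition minimal_in :: "'a rel \<Rightarrow> 'a set \<Rightarrow> 'a \<Rightarrow> bool" where
  "minimal_in r U u \<longleftrightarrow> u \<in> U \<and> (\<forall>v\<in>U. (v, u) \<in> r \<longrightarrow> v = u)"

lemma linear_extension_put_first:
  assumes "minimal_in r U u" and "s \<in> linear_extensions (U - {u}) (Restr r (U - {u}))"
  shows "s \<union> {u} \<times> U \<in> linear_extensions U (Restr r U)"
proof -
  have s: "refl_on (U - {u}) s" "trans s" "antisym s" "total_on (U - {u}) s"
    "s \<subseteq> (U - {u}) \<times> (U - {u})" "Restr r (U - {u}) \<subseteq> s"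
    using assms(2) by (auto simp: linear_extensions_def order_on_defs)
  have u: "u \<in> U" "\<And>v. v \<in> U \<Longrightarrow> (v, u) \<in> r \<Longrightarrow> v = u"
    using assms(1) by (auto simp: minimal_in_def)
  have "trans (s \<union> {u} \<times> U)"
    using s(2,5) u(1) unfolding trans_def by blast
  moreover have "antisym (s \<union> {u} \<times> U)"
    using s(3,5) unfolding antisym_def by blast
  moreover have "refl_on U (s \<union> {u} \<times> U)"
    using s(1) u(1) unfolding refl_on_def by blast
  moreover have "total_on U (s \<union> {u} \<times> U)"
    using s(4) u(1) unfolding total_on_def by blast
  moreover have "s \<union> {u} \<times> U \<subseteq> U \<times> U" using s(5) u(1) by blast
  moreover have "Restr r U \<subseteq> s \<union> {u} \<times> U" using s(6) u by blast
  ultimately show ?thesis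
    by (simp add: linear_extensions_def order_on_defs)
qed

lemma inj_on_put_first:
  "inj_on (\<lambda>s. s \<union> {u} \<times> U) (linear_extensions (U - {u}) (Restr r (U - {u})))"
proof (rule inj_onI)
  fix s s'
  assume s: "s \<in> linear_extensions (U - {u}) (Restr r (U - {u}))"
    and s': "s' \<in> linear_extensions (U - {u}) (Restr r (U - {u}))"
    and eq: "s \<union> {u} \<times> U = s' \<union> {u} \<times> U"
  have "s \<subseteq> (U - {u}) \<times> (U - {u})" "s' \<subseteq> (U - {u}) \<times> (U - {u})"
    using s s' by (auto simp: linear_extensions_def order_on_defs)
  then show "s = s'" using eq by blast
qed

lemma ext_count_remove_minimal:
  assumes "finite U" "minimal_in r U u"
  shows "ext_count r (U - {u}) \<le> ext_count r U"
  unfolding ext_count_def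
proof (rule card_inj_on_le[OF inj_on_put_first[of u U]])
  show "(\<lambda>s. s \<union> {u} \<times> U) ` linear_extensions (U - {u}) (Restr r (U - {u}))
    \<subseteq> linear_extensions U (Restr r U)"
    using linear_extension_put_first[OF assms(2)] by blast
qed (rule finite_linear_extensions[OF assms(1)])

text \<open>Extensions with \<open>u\<close> first and extensions with \<open>v\<close> first form
  disjoint families, since an order containing both \<open>(u, v)\<close> and \<open>(v, u)\<close>
  violates antisymmetry.\<close>

lemma ext_count_remove_two_minimal:
  assumes "finite U" "minimal_in r U u" "minimal_in r U v" "u \<noteq> v"
  shows "ext_count r (U - {u}) + ext_count r (U - {v}) \<le> ext_count r U"
proof -
  let ?L = "\<lambda>w. linear_extensions (U - {w}) (Restr r (U - {w}))"
  let ?f = "\<lambda>w s. s \<union> {w} \<times> U"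
  have fin: "finite (?L w)" for w using assms(1) by (intro finite_linear_extensions) simp
  have uv: "u \<in> U" "v \<in> U" using assms by (auto simp: minimal_in_def)
  have "?f u ` ?L u \<inter> ?f v ` ?L v = {}"
  proof (rule ccontr)
    assume "?f u ` ?L u \<inter> ?f v ` ?L v \<noteq> {}"
    then obtain s s' where s: "s \<in> ?L u" "s' \<in> ?L v" "s \<union> {u} \<times> U = s' \<union> {v} \<times> U" by blast
    have "antisym (s \<union> {u} \<times> U)"
      using linear_extension_put_first[OF assms(2) s(1)]
      by (auto simp: linear_extensions_def order_on_defs)
    moreover have "(u, v) \<in> s \<union> {u} \<times> U" using uv by blast
    moreover have "(v, u) \<in> s \<union> {u} \<times> U" unfolding s(3) using uv by blast
    ultimately show False using assms(4) by (auto dest: antisymD)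
  qed
  then have "card (?f u ` ?L u \<union> ?f v ` ?L v) = card (?L u) + card (?L v)"
    using fin by (subst card_Un_disjoint) (auto simp: card_image[OF inj_on_put_first])
  moreover have "?f u ` ?L u \<union> ?f v ` ?L v \<subseteq> linear_extensions U (Restr r U)"
    using linear_extension_put_first[OF assms(2)] linear_extension_put_first[OF assms(3)] by blast
  then have "card (?f u ` ?L u \<union> ?f v ` ?L v) \<le> card (linear_extensions U (Restr r U))"
    using assms(1) by (intro card_mono finite_linear_extensions)
  ultimately show ?thesis by (simp add: ext_count_def)
qed

section \<open>Up-sets and monotonicity of the count\<close>

definition up_closed :: "'a set \<Rightarrow> 'a rel \<Rightarrow> 'a set \<Rightarrow> bool" where
  "up_closed A r X \<longleftrightarrow> X \<subseteq> A \<and> (\<forall>u\<in>X. \<forall>v\<in>A. (u, v) \<in> r \<longrightarrow> v \<in> X)"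

lemma exists_minimal_in:
  assumes "finite A" "partial_order_on A r" "U \<noteq> {}"
  shows "\<exists>u. minimal_in r U u"
proof -
  have "finite r"
    using assms(1) partial_order_onD(4)[OF assms(2)] by (blast intro: finite_subset)
  then have "wf (r - Id)" using assms(2) by (rule partial_order_on_well_order_on)
  then obtain u where "u \<in> U" "\<And>y. (y, u) \<in> r - Id \<Longrightarrow> y \<notin> U"
    using assms(3) by (metis ex_in_conv wfE_min)
  then show ?thesis unfolding minimal_in_def by blast
qed

text \<open>The elements of \<open>U - X\<close> are peeled off one at a time. An element minimal in
  \<open>U - X\<close> is minimal in all of \<open>U\<close>, because nothing in the up-set
  \<open>X\<close> lies below an element outside it.\<close>

lemma ext_count_mono:
  assumes "finite A" "partial_order_on A r" "U \<subseteq> A" "up_closed A r X" "X \<subseteq> U"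
  shows "ext_count r X \<le> ext_count r U"
  using assms(3,5)
proof (induction "card U" arbitrary: U rule: less_induct)
  case less
  have fin: "finite U" using less.prems(1) assms(1) by (rule finite_subset)
  show ?case
  proof (cases "U = X")
    case False
    then have "U - X \<noteq> {}" using less.prems(2) by blast
    then obtain m where m: "minimal_in r (U - X) m"
      using exists_minimal_in[OF assms(1,2)] by blast
    then have "minimal_in r U m"
      using assms(4) less.prems unfolding minimal_in_def up_closed_def by blast
    then have "ext_count r (U - {m}) \<le> ext_count r U"
      by (rule ext_count_remove_minimal[OF fin])
    moreover have "m \<in> U" "m \<notin> X" using m by (auto simp: minimal_in_def)
    then have "ext_count r X \<le> ext_count r (U - {m})"
      using less.prems fin by (intro less.hyps card_Diff1_less) auto
    ultimately show ?thesis by linarith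
  qed simp
qed

text \<open>The form in which branching is used along the tape: what remains after \<open>u\<close>
  or \<open>v\<close> may be shrunk further to any up-set.\<close>

lemma ext_count_branch:
  assumes "finite A" "partial_order_on A r" "U \<subseteq> A"
    and "minimal_in r U u" "minimal_in r U v" "u \<noteq> v"
    and "up_closed A r X" "X \<subseteq> U - {u}" "up_closed A r Y" "Y \<subseteq> U - {v}"
  shows "ext_count r X + ext_count r Y \<le> ext_count r U"
proof -
  have fin: "finite U" using assms finite_subset by blast
  have "ext_count r X \<le> ext_count r (U - {u})" "ext_count r Y \<le> ext_count r (U - {v})"
    using assms by (auto intro!: ext_count_mono[OF assms(1,2)])
  then show ?thesis using ext_count_remove_two_minimal[OF fin assms(4-6)] by linarith
qed

section \<open>Interval layouts of posets of width two\<close>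

lemma up_closed_remove_minimal:
  "up_closed A r X \<Longrightarrow> minimal_in r X u \<Longrightarrow> up_closed A r (X - {u})"
  unfolding up_closed_def minimal_in_def by blast

text \<open>The combinatorial content of an optimal point: \<open>less_t_s\<close> turns strict
  comparability into disjointness of intervals, and \<open>cover\<close> is the convex
  representation of the point read at one position. Intervals are half-open, so an element ending at
  a position and one starting there are not both present.\<close>

locale tape =
  fixes A :: "'a set" and r :: "'a rel" and x s t :: "'a \<Rightarrow> real" and L :: real
  assumes fin: "finite A"
    and po: "partial_order_on A r"
    and no3: "(u, v) \<in> incomparability A r \<Longrightarrow> (v, w) \<in> incomparability A r
      \<Longrightarrow> (u, w) \<in> incomparability A r \<Longrightarrow> False"
    and x_pos: "v \<in> A \<Longrightarrow> 0 < x v"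
    and s_nonneg: "v \<in> A \<Longrightarrow> 0 \<le> s v"
    and t_eq: "v \<in> A \<Longrightarrow> t v = s v + 1 / x v"
    and t_le: "v \<in> A \<Longrightarrow> t v \<le> L"
    and less_t_s: "(u, v) \<in> r \<Longrightarrow> u \<noteq> v \<Longrightarrow> t u \<le> s v"
    and inc_x: "(u, v) \<in> incomparability A r \<Longrightarrow> x u + x v \<le> 1"
    and cover: "0 \<le> \<tau> \<Longrightarrow> \<tau> < L \<Longrightarrow> (\<Sum>v | v \<in> A \<and> s v \<le> \<tau> \<and> \<tau> < t v. x v) = 1"
begin

abbreviation inc :: "'a \<Rightarrow> 'a \<Rightarrow> bool" where
  "inc u v \<equiv> (u, v) \<in> incomparability A r"

definition act :: "real \<Rightarrow> 'a \<Rightarrow> bool" where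
  "act \<tau> v \<longleftrightarrow> v \<in> A \<and> s v \<le> \<tau> \<and> \<tau> < t v"

definition cut :: "real \<Rightarrow> bool" where
  "cut T \<longleftrightarrow> (\<forall>v\<in>A. \<not> (s v < T \<and> T < t v))"

definition F :: "real \<Rightarrow> 'a set" where
  "F \<tau> = {v \<in> A. \<tau> < t v}"

definition N :: "real \<Rightarrow> real" where
  "N \<tau> = real (ext_count r (F \<tau>))"

lemma inc_sym: "inc u v \<Longrightarrow> inc v u"
  by (auto simp: incomparability_def)

lemma inc_mem: "inc u v \<Longrightarrow> u \<in> A \<and> v \<in> A \<and> u \<noteq> v"
  by (auto simp: incomparability_def)

lemma inc_cases:
  assumes "u \<in> A" "v \<in> A" "u \<noteq> v"
  obtains "inc u v" | "(u, v) \<in> r" | "(v, u) \<in> r"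
  using assms by (auto simp: incomparability_def)

lemma r_trans: "(u, v) \<in> r \<Longrightarrow> (v, w) \<in> r \<Longrightarrow> (u, w) \<in> r"
  using partial_order_onD(2)[OF po] by (rule transD)

lemma not_inc: "(u, v) \<in> r \<Longrightarrow> \<not> inc u v" "(u, v) \<in> r \<Longrightarrow> \<not> inc v u"
  by (auto simp: incomparability_def)

section \<open>Elements present at a point of the tape\<close>

lemma s_less_t: "v \<in> A \<Longrightarrow> s v < t v"
  using x_pos[of v] t_eq[of v] by simp

lemma act_mem: "act \<tau> v \<Longrightarrow> v \<in> A \<and> s v \<le> \<tau> \<and> \<tau> < t v"
  by (simp add: act_def)

lemma act_range: "act \<tau> v \<Longrightarrow> 0 \<le> \<tau> \<and> \<tau> < L"
  using s_nonneg t_le act_mem by (meson order.trans order_less_le_trans)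

lemma act_inc:
  assumes "act \<tau> u" "act \<tau> v" "u \<noteq> v"
  shows "inc u v"
proof -
  have "(u, v) \<notin> r" "(v, u) \<notin> r"
    using assms act_mem less_t_s by (metis not_le order.trans)+
  then show ?thesis using assms act_mem by (metis inc_cases)
qed

text \<open>The values present at \<open>\<tau>\<close> sum to \<open>1\<close>, so something is
  present, and a lone element carries the whole sum.\<close>

lemma act_cases:
  assumes "0 \<le> \<tau>" "\<tau> < L"
  obtains (single) u where "act \<tau> u" "x u = 1" "\<And>v. act \<tau> v \<Longrightarrow> v = u"
  | (double) u v where "act \<tau> u" "act \<tau> v" "u \<noteq> v"
proof -
  let ?S = "{v \<in> A. s v \<le> \<tau> \<and> \<tau> < t v}"
  have sum: "sum x ?S = 1" using cover[OF assms] by simp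
  then have "?S \<noteq> {}" by (metis sum.empty zero_neq_one)
  then obtain u where u: "u \<in> ?S" by blast
  show thesis
  proof (cases "?S = {u}")
    case True
    then have "x u = 1" using sum by simp
    moreover have "act \<tau> u" using u by (simp add: act_def)
    moreover have "v = u" if "act \<tau> v" for v
    proof -
      have "v \<in> ?S" using that by (simp add: act_def)
      then show ?thesis unfolding True by simp
    qed
    ultimately show thesis by (intro single)
  next
    case False
    then obtain v where "v \<in> ?S" "v \<noteq> u" using u by blast
    with u show thesis by (intro double[of u v]) (simp_all add: act_def)
  qed
qed

text \<open>Elements present together are pairwise incomparable, so \<open>no3\<close> rules out a
  third one. Many later arguments about positions end in this contradiction.\<close>

lemma act_only:
  assumes "act \<tau> a" "act \<tau> b" "a \<noteq> b" "act \<tau> c"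
  shows "c = a \<or> c = b"
  using assms act_inc no3 by metis

lemma act_sum:
  assumes "act \<tau> a" "act \<tau> b" "a \<noteq> b"
  shows "x a + x b = 1"
proof -
  have "{v \<in> A. s v \<le> \<tau> \<and> \<tau> < t v} = {a, b}"
    using assms act_only[OF assms] by (auto simp: act_def)
  moreover have "0 \<le> \<tau>" "\<tau> < L" using act_range assms(1) by auto
  ultimately show ?thesis using cover[of \<tau>] assms(3) by simp
qed

lemma x_less_one: "inc u v \<Longrightarrow> x u < 1"
  using inc_x[of u v] x_pos[of v] inc_mem[of u v] by linarith

lemma act_partner:
  assumes "act \<tau> a" "x a < 1"
  obtains b where "act \<tau> b" "b \<noteq> a" "x b = 1 - x a"
proof -
  have "0 \<le> \<tau>" "\<tau> < L" using act_range assms(1) by auto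
  then obtain b where "act \<tau> b" "b \<noteq> a"
  proof (cases rule: act_cases)
    case (single u)
    then show ?thesis using assms by fastforce
  next
    case (double u v)
    then show ?thesis using that by metis
  qed
  with act_sum[OF this(1) assms(1) this(2)] show ?thesis using that by simp
qed

lemma act_start: "v \<in> A \<Longrightarrow> act (s v) v"
  using s_less_t by (simp add: act_def)

lemma overlap_act:
  assumes "u \<in> A" "v \<in> A" "s u < t v" "s v < t u"
  shows "act (max (s u) (s v)) u" "act (max (s u) (s v)) v"
  using assms s_less_t by (auto simp: act_def max_def)

lemma x_eq_of_length:
  assumes "u \<in> A" "v \<in> A" "t u - s u = t v - s v"
  shows "x u = x v"
  using assms t_eq[of u] t_eq[of v] x_pos[of u] x_pos[of v] by simp

section \<open>Remainders of the poset along the tape\<close>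

lemma up_closed_F: "up_closed A r (F \<tau>)"
  unfolding up_closed_def F_def
proof (intro conjI ballI impI)
  fix u v assume "u \<in> {v \<in> A. \<tau> < t v}" "v \<in> A" "(u, v) \<in> r"
  then show "v \<in> {v \<in> A. \<tau> < t v}"
    using less_t_s[of u v] s_less_t[of v] by (cases "u = v") auto
qed blast

lemma F_subset: "F \<tau> \<subseteq> A"
  by (auto simp: F_def)

lemma finite_F: "finite (F \<tau>)"
  using fin F_subset by (rule finite_subset[rotated])

lemma act_minimal: "act \<tau> u \<Longrightarrow> minimal_in r (F \<tau>) u"
  unfolding minimal_in_def F_def using less_t_s act_mem by fastforce

lemma ext_count_mono': "up_closed A r X \<Longrightarrow> X \<subseteq> U \<Longrightarrow> U \<subseteq> A \<Longrightarrow> ext_count r X \<le> ext_count r U"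
  using ext_count_mono[OF fin po] by blast

lemma F_mono: "\<tau> \<le> \<tau>' \<Longrightarrow> F \<tau>' \<subseteq> F \<tau>"
  by (auto simp: F_def)

lemma N_mono: "\<tau> \<le> \<tau>' \<Longrightarrow> N \<tau>' \<le> N \<tau>"
  unfolding N_def using ext_count_mono'[OF up_closed_F F_mono F_subset] by simp

lemma F_end_subset:
  assumes "act \<tau> a"
  shows "F (t a) \<subseteq> F \<tau> - {a}"
  using assms by (auto simp: F_def act_def)

text \<open>The basic recursion for lower bounds on \<open>N\<close>: both present elements are
  minimal in \<open>F \<tau>\<close>, and taking one of them first leaves at least what remains
  after its end.\<close>

lemma N_branch:
  assumes "act \<tau> a" "act \<tau> b" "a \<noteq> b"
  shows "N (t a) + N (t b) \<le> N \<tau>"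
proof -
  have "ext_count r (F (t a)) + ext_count r (F (t b)) \<le> ext_count r (F \<tau>)"
    by (rule ext_count_branch[OF fin po F_subset act_minimal[OF assms(1)] act_minimal[OF assms(2)]
          assms(3) up_closed_F F_end_subset[OF assms(1)] up_closed_F F_end_subset[OF assms(2)]])
  then show ?thesis unfolding N_def by linarith
qed

lemma N_end_le:
  assumes "act \<tau> a"
  shows "N (t a) \<le> real (ext_count r (F \<tau> - {a}))"
  unfolding N_def using ext_count_mono'[OF up_closed_F F_end_subset[OF assms]] F_subset
  by (meson Diff_subset of_nat_mono order.trans)

text \<open>Otherwise \<open>v\<close> would be present together with \<open>a\<close> and
  \<open>b\<close> at \<open>max \<tau> (s v)\<close>. Hence passing the earlier end drops only
  those elements of the pair that end there.\<close>

lemma F_between: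
  assumes "act \<tau> a" "act \<tau> b" "a \<noteq> b" "t b \<le> t a" "v \<in> F \<tau>" "v \<noteq> a" "v \<noteq> b"
  shows "t b < t v"
proof (rule ccontr)
  assume "\<not> t b < t v"
  then have "act (max \<tau> (s v)) v" "act (max \<tau> (s v)) a" "act (max \<tau> (s v)) b"
    using assms s_less_t[of v] by (auto simp: act_def F_def max_def)
  then show False using act_only assms by metis
qed

lemma F_step:
  assumes "act \<tau> a" "act \<tau> b" "a \<noteq> b" "t b < t a"
  shows "F \<tau> = insert b (F (t b))" "b \<notin> F (t b)"
proof -
  have "t b < t v" if "v \<in> F \<tau>" "v \<noteq> b" for v
    using F_between[OF assms(1-3) _ that(1)] that assms(4) by (cases "v = a") auto
  then show "F \<tau> = insert b (F (t b))"
    using assms by (auto simp: F_def act_def)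
qed (simp add: F_def)

lemma F_tie:
  assumes "act \<tau> a" "act \<tau> b" "a \<noteq> b" "t b = t a"
  shows "F \<tau> = insert a (insert b (F (t a)))" "a \<notin> insert b (F (t a))" "b \<notin> F (t a)"
proof -
  have "t b < t v" if "v \<in> F \<tau>" "v \<noteq> b" "v \<noteq> a" for v
    using F_between[OF assms(1-3) _ that(1)] that assms(4) by auto
  then show "F \<tau> = insert a (insert b (F (t a)))"
    using assms by (auto simp: F_def act_def)
qed (use assms in \<open>auto simp: F_def\<close>)

text \<open>While \<open>a\<close> continues, whatever is beside it has value
  \<open>1 - x a\<close>; the partner found at \<open>t b\<close> cannot have started earlier, as it
  would have been a third element. So the partners of \<open>a\<close> follow one another without
  gaps and with equal lengths.\<close>

lemma next_partner:
  assumes "act \<tau> a" "act \<tau> b" "a \<noteq> b" "t b < t a"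
  obtains b' where "act (t b) b'" "b' \<noteq> a" "s b' = t b" "x b' = x b" "act (t b) a"
    "t b' - s b' = t b - s b"
proof -
  have a: "act (t b) a" using assms s_less_t[of b] by (auto simp: act_def)
  have ab: "x a + x b = 1" by (rule act_sum[OF assms(1-3)])
  then have "x a < 1" using x_pos[of b] assms(2) act_mem by force
  then obtain b' where b': "act (t b) b'" "b' \<noteq> a" "x b' = 1 - x a" using a act_partner by blast
  have "s b' = t b"
  proof (rule ccontr)
    assume "s b' \<noteq> t b"
    then have "s b' < t b" using b' act_mem by fastforce
    then have "act (max \<tau> (s b')) b'" "act (max \<tau> (s b')) a" "act (max \<tau> (s b')) b"
      using assms(1,2,4) b'(1) by (auto simp: act_def max_def)
    then have "b' = b" using act_only assms(3) b'(2) by metis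
    then show False using b'(1) by (simp add: act_def)
  qed
  moreover have "x b' = x b" using ab b'(3) by simp
  moreover have "t b' - s b' = t b - s b"
    using t_eq[of b'] t_eq[of b] b'(1) assms(2) act_mem calculation(2) by force
  ultimately show thesis using that b' a by blast
qed

lemma tie_cut:
  assumes "act \<tau> a" "act \<tau> b" "a \<noteq> b" "t b = t a"
  shows "cut (t a)"
  unfolding cut_def
proof (intro ballI notI)
  fix v assume v: "v \<in> A" "s v < t a \<and> t a < t v"
  then have "act (max \<tau> (s v)) v" "act (max \<tau> (s v)) a" "act (max \<tau> (s v)) b"
    using assms by (auto simp: act_def max_def)
  then have "v = a \<or> v = b" using act_only assms(3) by metis
  then show False using v assms by auto
qed

lemma single_cut:
  assumes "act \<tau> u" "x u = 1"
  shows "cut (t u)"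
  unfolding cut_def
proof (intro ballI notI)
  fix v assume v: "v \<in> A" "s v < t u \<and> t u < t v"
  then have "act (max \<tau> (s v)) v" "act (max \<tau> (s v)) u"
    using assms by (auto simp: act_def max_def)
  then have "v = u" using act_inc x_less_one assms by (metis less_irrefl)
  then show False using v by auto
qed

section \<open>Incomparabilities across a cut\<close>

lemma cut_act_start: "cut T \<Longrightarrow> act T v \<Longrightarrow> s v = T"
  unfolding cut_def act_def by force

text \<open>An incomparability passing over a cut can be moved to an element starting there. A lone
  element at \<open>T\<close> is comparable to everything and would put \<open>a\<close> below
  \<open>v\<close>. Of two elements at \<open>T\<close>, one equals or lies below \<open>v\<close>
  by \<open>no3\<close>, and \<open>a\<close> cannot lie below that one.\<close>

lemma right_cross:
  assumes "cut T" "inc a v" "t a \<le> T" "T \<le> s v"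
  obtains c where "act T c" "s c = T" "inc a c"
proof -
  have mem: "a \<in> A" "v \<in> A" using inc_mem assms by auto
  have *: "u = v \<or> (u, v) \<in> r \<or> inc u v" and **: "(a, u) \<in> r \<or> inc a u" if "act T u" for u
  proof -
    have u: "u \<in> A" "s u = T" using that cut_act_start[OF assms(1)] act_mem by auto
    then have "\<not> ((v, u) \<in> r \<and> v \<noteq> u)" "\<not> ((u, a) \<in> r \<and> u \<noteq> a)" "u \<noteq> a"
      using less_t_s[of v u] less_t_s[of u a] assms(3,4) s_less_t[of v] s_less_t[of u] s_less_t[of a]
        mem by force+
    then show "u = v \<or> (u, v) \<in> r \<or> inc u v" "(a, u) \<in> r \<or> inc a u"
      using inc_cases[of u v] inc_cases[of a u] u(1) mem by auto
  qed
  have "0 \<le> T" using assms(3) s_nonneg[of a] s_less_t[of a] mem by linarith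
  moreover have "T < L" using assms(4) s_less_t[of v] t_le[of v] mem by linarith
  ultimately obtain c where "act T c" "inc a c"
  proof (cases rule: act_cases)
    case (single u)
    then have "\<not> inc u v" "\<not> inc a u"
      using x_less_one inc_sym by (metis less_irrefl)+
    then have "(a, u) \<in> r" "u = v \<or> (u, v) \<in> r" using *[OF single(1)] **[OF single(1)] by blast+
    then show ?thesis using assms(2) not_inc(1) r_trans by blast
  next
    case (double u w)
    have "\<not> (inc u v \<and> inc w v)" using no3 act_inc[OF double] inc_sym by blast
    then obtain c where c: "act T c" "c = v \<or> (c, v) \<in> r" using *[OF double(1)] *[OF double(2)] double(1,2) by blast
    then have "(a, c) \<notin> r" using assms(2) not_inc(1) r_trans by blast
    then show ?thesis using **[OF c(1)] c(1) that by blast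
  qed
  then show thesis using that cut_act_start[OF assms(1)] by blast
qed

text \<open>Elements ending at \<open>T\<close> are not present at \<open>T\<close> itself, so a
  point shortly before is needed. The last end before \<open>T\<close>, or \<open>0\<close>, works:
  what is present there cannot end before \<open>T\<close>, and the cut forbids running past
  \<open>T\<close>.\<close>

lemma cut_before:
  assumes "cut T" "0 < T"
  obtains \<tau> where "0 \<le> \<tau>" "\<tau> < T" "\<And>c. act \<tau> c \<Longrightarrow> t c = T"
proof -
  define \<tau> where "\<tau> = Max (insert 0 {t v | v. v \<in> A \<and> t v < T})"
  have fin': "finite (insert 0 {t v | v. v \<in> A \<and> t v < T})" using fin by simp
  have "\<tau> \<in> insert 0 {t v | v. v \<in> A \<and> t v < T}" unfolding \<tau>_def using fin' by (intro Max_in) auto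
  then have "\<tau> < T" using assms(2) by auto
  moreover have "0 \<le> \<tau>" unfolding \<tau>_def using fin' by (intro Max_ge) auto
  moreover have "t c = T" if c: "act \<tau> c" for c
  proof (rule ccontr)
    assume ne: "t c \<noteq> T"
    have "\<not> (s c < T \<and> T < t c)" using assms(1) c unfolding cut_def act_def by blast
    then have "t c < T" using ne c \<open>\<tau> < T\<close> by (auto simp: act_def)
    then have "t c \<le> \<tau>" unfolding \<tau>_def using fin' c by (intro Max_ge) (auto simp: act_def)
    then show False using c by (simp add: act_def)
  qed
  ultimately show thesis using that by blast
qed

text \<open>Mirror image of \<open>right_cross\<close>, read at the point supplied by
  \<open>cut_before\<close>.\<close>

lemma left_cross:
  assumes "cut T" "inc v a" "t v \<le> T" "T \<le> s a"
  obtains c where "c \<in> A" "t c = T" "inc c a"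
proof -
  have mem: "a \<in> A" "v \<in> A" using inc_mem assms by auto
  have "0 < T" using assms(3) s_nonneg[of v] s_less_t[of v] mem by linarith
  then obtain \<tau> where \<tau>: "0 \<le> \<tau>" "\<tau> < T" "\<And>c. act \<tau> c \<Longrightarrow> t c = T" using cut_before[OF assms(1)] by blast
  have *: "u = v \<or> (v, u) \<in> r \<or> inc v u" and **: "(u, a) \<in> r \<or> inc u a" if "act \<tau> u" for u
  proof -
    have u: "u \<in> A" "t u = T" using that \<tau>(3) act_mem by auto
    then have "\<not> ((u, v) \<in> r \<and> v \<noteq> u)" "\<not> ((a, u) \<in> r \<and> u \<noteq> a)" "u \<noteq> a"
      using less_t_s[of u v] less_t_s[of a u] assms(3,4) s_less_t[of v] s_less_t[of u] s_less_t[of a]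
        mem by force+
    then show "u = v \<or> (v, u) \<in> r \<or> inc v u" "(u, a) \<in> r \<or> inc u a"
      using inc_cases[of v u] inc_cases[of u a] u(1) mem by auto
  qed
  have "\<tau> < L" using \<tau>(2) assms(4) s_less_t[of a] t_le[of a] mem by linarith
  with \<tau>(1) obtain c where "act \<tau> c" "inc c a"
  proof (cases rule: act_cases)
    case (single u)
    then have "\<not> inc v u" "\<not> inc u a"
      using x_less_one inc_sym by (metis less_irrefl)+
    then have "(u, a) \<in> r" "u = v \<or> (v, u) \<in> r" using *[OF single(1)] **[OF single(1)] by blast+
    then show ?thesis using assms(2) not_inc(1) r_trans by blast
  next
    case (double u w)
    have "\<not> (inc v u \<and> inc v w)" using no3 act_inc[OF double] inc_sym by blast
    then obtain c where c: "act \<tau> c" "c = v \<or> (v, c) \<in> r" using *[OF double(1)] *[OF double(2)] double(1,2) by blast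
    then have "(c, a) \<notin> r" using assms(2) not_inc(1) r_trans by blast
    then show ?thesis using **[OF c(1)] c(1) that by blast
  qed
  then show thesis using that \<tau>(3) act_mem by blast
qed

text \<open>Taking \<open>a\<close> first, or \<open>b\<close> and then \<open>a\<close>, leaves at
  least \<open>F (t a)\<close> each time. After \<open>b\<close> alone, \<open>b'\<close> is minimal
  besides \<open>a\<close> because it is incomparable to \<open>a\<close>; taking it next gives the
  third family. This is how an incomparability across a cut yields extra extensions.\<close>

lemma N_cross_branch:
  assumes "act \<tau> a" "act \<tau> b" "a \<noteq> b" "t b = t a" "act (t a) b'" "s b' = t a" "inc a b'"
  shows "2 * N (t a) + real (ext_count r (F (t a) - {b'})) \<le> N \<tau>"
proof -
  have b': "minimal_in r (F (t a)) b'" using assms(5) by (rule act_minimal)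
  note F = F_tie[OF assms(1-4)]
  have up: "up_closed A r (F \<tau> - {b})"
    using up_closed_F act_minimal[OF assms(2)] by (rule up_closed_remove_minimal)
  have 1: "ext_count r (F (t a)) + ext_count r (F \<tau> - {b}) \<le> ext_count r (F \<tau>)"
    by (rule ext_count_branch[OF fin po F_subset act_minimal[OF assms(1)] act_minimal[OF assms(2)]
          assms(3) up_closed_F F_end_subset[OF assms(1)] up subset_refl])
  have min_a: "minimal_in r (F \<tau> - {b}) a"
    using act_minimal[OF assms(1)] assms(3) by (auto simp: minimal_in_def)
  have min_b': "minimal_in r (F \<tau> - {b}) b'"
    using b' F not_inc(1)[of a b'] assms(7) unfolding minimal_in_def by auto
  have "ext_count r (F (t a)) + ext_count r (F (t a) - {b'}) \<le> ext_count r (F \<tau> - {b})"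
    using F F_subset[of \<tau>] b' assms(7) inc_mem[of a b']
    by (intro ext_count_branch[OF fin po _ min_a min_b'] up_closed_F up_closed_remove_minimal) auto
  with 1 show ?thesis unfolding N_def by linarith
qed

section \<open>Isolated edges of the incomparability graph\<close>

definition iso :: "'a \<Rightarrow> bool" where
  "iso v \<longleftrightarrow> (\<exists>u. inc v u \<and> (\<forall>w. inc v w \<longrightarrow> w = u) \<and> (\<forall>w. inc u w \<longrightarrow> w = v))"

lemma iso_act:
  assumes "act \<tau> a" "act \<tau> b" "a \<noteq> b" "iso a"
  shows "iso b" "\<And>w. inc a w \<Longrightarrow> w = b" "\<And>w. inc b w \<Longrightarrow> w = a"
  using assms(4) act_inc[OF assms(1-3)] inc_sym unfolding iso_def by metis+

text \<open>The two elements of an isolated edge occupy the same interval: if one began later or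
  ended earlier, the partner beside the rest of the other would be a second incomparable element.
  Equal lengths give equal values, with sum \<open>1\<close>.\<close>

lemma iso_half:
  assumes "iso a"
  shows "x a = 1 / 2"
proof -
  have a: "a \<in> A" "x a < 1" using assms x_less_one inc_mem unfolding iso_def by blast+
  then obtain b where b: "act (s a) b" "b \<noteq> a" using act_partner[OF act_start] by blast
  note isb = iso_act[OF act_start[OF a(1)] b(1) b(2)[symmetric] assms]
  have "\<not> t b < t a"
  proof
    assume "t b < t a"
    then obtain b2 where "act (t b) b2" "act (t b) a" "b2 \<noteq> a"
      using next_partner[OF act_start[OF a(1)] b(1) b(2)[symmetric]] by blast
    then have "b2 = b" using act_inc isb(2) by blast
    then show False using \<open>act (t b) b2\<close> by (simp add: act_def)
  qed
  moreover have "\<not> t a < t b"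
  proof
    assume "t a < t b"
    then obtain b2 where "act (t a) b2" "act (t a) b" "b2 \<noteq> b"
      using next_partner[OF b(1) act_start[OF a(1)] b(2)] by blast
    then have "b2 = a" using act_inc isb(3) by blast
    then show False using \<open>act (t a) b2\<close> by (simp add: act_def)
  qed
  moreover have "s b = s a"
  proof -
    have "b \<in> A" "x b < 1" using b isb(1) x_less_one act_mem unfolding iso_def by blast+
    then obtain c where c: "act (s b) c" "c \<noteq> b" using act_partner[OF act_start] by blast
    then have "c = a" using isb(3) act_inc act_start \<open>b \<in> A\<close> by blast
    then show ?thesis using c b by (simp add: act_def)
  qed
  ultimately have "x a = x b" using a b act_mem by (intro x_eq_of_length) auto
  then show ?thesis using act_sum[OF act_start[OF a(1)] b(1) b(2)[symmetric]] by simp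
qed

end

section \<open>The lower bound on the number of linear extensions\<close>

text \<open>In \<open>wt_star\<close>, \<open>m\<close> counts the elements ending beside
  \<open>a\<close>. The right-hand sides come from the star count \<open>m + 1\<close>: one factor
  \<open>\<beta>^2\<close> is charged either for a debt to the right or for the stronger boundary
  inequality, and \<open>\<beta>^4\<close> for both at once.\<close>

locale weighted_tape = tape A r x s t L for A :: "'a set" and r x s t L +
  fixes wt :: "'a \<Rightarrow> real" and \<beta> :: real
  assumes wt_pos: "v \<in> A \<Longrightarrow> 0 < wt v"
    and wt_single: "v \<in> A \<Longrightarrow> x v = 1 \<Longrightarrow> wt v = 1"
    and wt_iso: "iso v \<Longrightarrow> wt v = sqrt 2"
    and wt_middle: "v \<in> A \<Longrightarrow> \<not> iso v \<Longrightarrow> 1 / 3 < x v \<Longrightarrow> x v < 2 / 3 \<Longrightarrow> wt v = \<beta>"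
    and wt_cong: "u \<in> A \<Longrightarrow> v \<in> A \<Longrightarrow> \<not> iso u \<Longrightarrow> \<not> iso v \<Longrightarrow> x u = x v \<Longrightarrow> wt u = wt v"
    and wt_star: "a \<in> A \<Longrightarrow> b \<in> A \<Longrightarrow> x a \<le> 1 / 3 \<Longrightarrow> x b = 1 - x a
      \<Longrightarrow> 1 / x a - 2 < real m \<Longrightarrow> real m < 1 / x a
      \<Longrightarrow> wt a * wt b ^ m \<le> real m + 1 \<and> \<beta>^2 * (wt a * wt b ^ m) \<le> 2 * real m + 3
        \<and> \<beta>^4 * (wt a * wt b ^ m) \<le> 4 * real m + 8"
    and \<beta>_ge_1: "1 \<le> \<beta>" and \<beta>_power_6: "\<beta>^6 \<le> 11"
begin

section \<open>Weights of remainders and powers of \<beta>\<close>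

definition Bd :: "real \<Rightarrow> real" where
  "Bd \<tau> = prod wt (F \<tau>)"

abbreviation S :: "real \<Rightarrow> 'a \<Rightarrow> real" where
  "S \<tau> v \<equiv> real (ext_count r (F \<tau> - {v}))"

lemma Bd_pos: "0 < Bd \<tau>"
  unfolding Bd_def using wt_pos F_subset by (intro prod_pos) blast

text \<open>All bounds on powers of \<open>\<beta>\<close> are extracted from
  \<open>\<beta>^6 \<le> 11\<close>. The integers bounding \<open>\<beta>^5\<close> to
  \<open>\<beta>^9\<close> are the coefficients demanded by \<open>crossing_tie\<close> and
  \<open>crossing_tie_debt\<close>.\<close>

lemma \<beta>_power_2: "\<beta>^2 \<le> 223 / 100"
proof (rule ccontr)
  assume "\<not> ?thesis"
  then have "(223 / 100)^3 < (\<beta>^2)^3" by (intro power_strict_mono) auto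
  also have "(\<beta>^2)^3 \<le> 11" using \<beta>_power_6 by (simp flip: power_mult)
  finally show False by (simp add: power3_eq_cube)
qed

lemma \<beta>_power_3: "\<beta>^3 \<le> 10 / 3"
proof (rule ccontr)
  assume "\<not> ?thesis"
  then have "(10 / 3)^2 < (\<beta>^3)^2" by (intro power_strict_mono) auto
  also have "(\<beta>^3)^2 \<le> 11" using \<beta>_power_6 by (simp flip: power_mult)
  finally show False by (simp add: power2_eq_square)
qed

lemma \<beta>_power_4: "\<beta>^4 \<le> 5"
proof -
  have "\<beta>^2 * \<beta>^2 \<le> (223 / 100) * (223 / 100)"
    using \<beta>_power_2 by (intro mult_mono) auto
  then show ?thesis by (simp flip: power_add)
qed

lemma \<beta>_power_5: "\<beta>^5 \<le> 8"
proof -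
  have "\<beta>^2 * \<beta>^3 \<le> (223 / 100) * (10 / 3)"
    using \<beta>_power_2 \<beta>_power_3 \<beta>_ge_1 by (intro mult_mono) auto
  then show ?thesis by (simp flip: power_add)
qed

lemma \<beta>_power_7: "\<beta>^7 \<le> 19"
proof -
  have "\<beta>^3 * \<beta>^4 \<le> (10 / 3) * 5"
    using \<beta>_power_4 \<beta>_power_3 \<beta>_ge_1 by (intro mult_mono) auto
  then show ?thesis by (simp flip: power_add)
qed

lemma \<beta>_power_8: "\<beta>^8 \<le> 26"
proof -
  have "\<beta>^4 * \<beta>^4 \<le> 5 * 5"
    using \<beta>_power_4 \<beta>_ge_1 by (intro mult_mono) auto
  then show ?thesis by (simp flip: power_add)
qed

lemma \<beta>_power_9: "\<beta>^9 \<le> 45"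
proof -
  have "\<beta>^5 * \<beta>^4 \<le> 8 * 5"
    using \<beta>_power_4 \<beta>_power_5 \<beta>_ge_1 by (intro mult_mono) auto
  then show ?thesis by (simp flip: power_add)
qed

section \<open>Steps along the tape and stars\<close>

lemma Bd_step:
  assumes "act \<tau> a" "act \<tau> b" "a \<noteq> b" "t b < t a"
  shows "Bd \<tau> = wt b * Bd (t b)"
  unfolding Bd_def F_step(1)[OF assms] using F_step(2)[OF assms] finite_F by simp

lemma Bd_tie:
  assumes "act \<tau> a" "act \<tau> b" "a \<noteq> b" "t b = t a"
  shows "Bd \<tau> = wt a * wt b * Bd (t a)"
  unfolding Bd_def F_tie(1)[OF assms] using F_tie(2,3)[OF assms] finite_F by simp

lemma card_F_less:
  assumes "act \<tau> a" "t a \<le> \<tau>'"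
  shows "card (F \<tau>') < card (F \<tau>)"
proof -
  have "a \<in> F \<tau>" "a \<notin> F \<tau>'" "F \<tau>' \<subseteq> F \<tau>" using assms by (auto simp: F_def act_def)
  then show ?thesis using finite_F by (intro psubset_card_mono) auto
qed

text \<open>Some \<open>b\<close> runs across \<open>t a\<close>, so \<open>next_partner\<close>
  with the roles exchanged supplies a successor of \<open>a\<close> with the same value.\<close>

lemma next_start:
  assumes "a \<in> A" "\<not> cut (t a)"
  obtains a' b where "act (t a) a'" "s a' = t a" "x a' = x a" "act (t a) b" "b \<noteq> a'" "s b < t a"
proof -
  obtain b where b: "b \<in> A" "s b < t a" "t a < t b" using assms(2) unfolding cut_def by blast
  have "s a < t b" using b(3) s_less_t[OF assms(1)] by linarith
  note act = overlap_act[OF assms(1) b(1) this b(2)]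
  have "b \<noteq> a" using b by auto
  from next_partner[OF act(2) act(1) this b(3)] show thesis using that b(2) by metis
qed

text \<open>The elements ending while \<open>a\<close> is present are consecutive and have the same length, which
  determines their number up to one. The bonus \<open>E\<close> counts the extensions that move \<open>a\<close> beyond
  an element starting at the cut where \<open>a\<close> ends.\<close>

lemma star_chain:
  assumes "act \<tau> a" "act \<tau> b" "a \<noteq> b" "x a \<noteq> 1 / 2"
    and tie: "\<And>\<tau> b. act \<tau> a \<Longrightarrow> act \<tau> b \<Longrightarrow> a \<noteq> b \<Longrightarrow> t b = t a \<Longrightarrow> 2 * N (t a) + E \<le> N \<tau>"
    and cross: "\<not> cut (t a) \<Longrightarrow> E = 0"
  shows "\<exists>m. (real m + 1) * N (t a) + E \<le> N \<tau> \<and> Bd \<tau> = wt a * wt b ^ m * Bd (t a)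
    \<and> t b + (real m - 1) * (t b - s b) \<le> t a \<and> t a < t b + real m * (t b - s b)"
  using assms(1-3)
proof (induction "card (F \<tau>)" arbitrary: \<tau> b rule: less_induct)
  case less
  note act = less.prems
  have b: "b \<in> A" "s b \<le> \<tau>" "\<tau> < t b" "\<tau> < t a" using act act_mem by auto
  consider "t a < t b" | "t b = t a" | "t b < t a" by linarith
  then show ?case
  proof cases
    case 1
    \<comment> \<open>\<open>b\<close> outlives \<open>a\<close>, so nothing more ends beside
      \<open>a\<close>: \<open>m = 0\<close>, and no bonus is due.\<close>
    then have "\<not> cut (t a)" using b unfolding cut_def by force
    then have "E = 0" by (rule cross)
    moreover have "N (t a) \<le> N \<tau>" using b by (intro N_mono) simp
    ultimately show ?thesis
      using 1 Bd_step[OF act(2,1) act(3)[symmetric]] b by (intro exI[of _ 0]) auto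
  next
    case 2
    then show ?thesis
      using tie[OF act] Bd_tie[OF act] s_less_t[OF b(1)] by (intro exI[of _ 1]) auto
  next
    case 3
    obtain b' where b': "act (t b) b'" "b' \<noteq> a" "s b' = t b" "x b' = x b" "act (t b) a"
      "t b' - s b' = t b - s b"
      using next_partner[OF act 3] by blast
    obtain m where m: "(real m + 1) * N (t a) + E \<le> N (t b)"
      "Bd (t b) = wt a * wt b' ^ m * Bd (t a)"
      "t b' + (real m - 1) * (t b' - s b') \<le> t a" "t a < t b' + real m * (t b' - s b')"
      using less.hyps[OF card_F_less[OF act(2) order_refl] b'(5,1)] b'(2) by metis
    have "x b = 1 - x a" using act_sum[OF act] by simp
    \<comment> \<open>\<open>wt_cong\<close> excludes isolated elements; these have value
      \<open>1 / 2\<close>, which \<open>x a \<noteq> 1 / 2\<close> keeps out.\<close>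
    then have "\<not> iso b" "\<not> iso b'" using iso_half[of b] iso_half[of b'] assms(4) b'(4) by auto
    then have wt: "wt b' = wt b" using b' b(1) act_mem by (intro wt_cong) auto
    have "N (t a) + N (t b) \<le> N \<tau>" by (rule N_branch[OF act])
    then have 1: "(real (Suc m) + 1) * N (t a) + E \<le> N \<tau>" using m(1) by (simp add: algebra_simps)
    have 2: "Bd \<tau> = wt a * wt b ^ Suc m * Bd (t a)" using Bd_step[OF act 3] m(2) wt by simp
    have "t b' = t b + (t b - s b)" using b' by simp
    then have 3: "t b + (real (Suc m) - 1) * (t b - s b) \<le> t a"
      "t a < t b + real (Suc m) * (t b - s b)"
      using m(3,4) b'(6) by (simp_all add: algebra_simps)
    show ?thesis using 1 2 3 by blast
  qed
qed

text \<open>With \<open>w = 1 / x a\<close> and the partner length \<open>v = 1 / (1 - x a)\<close>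
  one has \<open>w = (w - 1) * v\<close>. Comparing the partner ends with \<open>t a\<close> gives
  \<open>(m - 1) * v < w < (m + 1) * v\<close>, that is \<open>w - 2 < m < w\<close>, the window of
  \<open>wt_star\<close>.\<close>

lemma star:
  assumes "act (s a) a" "act (s a) b" "a \<noteq> b" "x a \<le> 1 / 3"
    and "\<And>\<tau> b. act \<tau> a \<Longrightarrow> act \<tau> b \<Longrightarrow> a \<noteq> b \<Longrightarrow> t b = t a \<Longrightarrow> 2 * N (t a) + E \<le> N \<tau>"
    and "\<not> cut (t a) \<Longrightarrow> E = 0"
  obtains m where "(real m + 1) * N (t a) + E \<le> N (s a)" "Bd (s a) = wt a * wt b ^ m * Bd (t a)"
    "wt a * wt b ^ m \<le> real m + 1" "\<beta>^2 * (wt a * wt b ^ m) \<le> 2 * real m + 3"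
    "\<beta>^4 * (wt a * wt b ^ m) \<le> 4 * real m + 8"
proof -
  have "x a \<noteq> 1 / 2" using assms(4) by simp
  then obtain m where m:
    "(real m + 1) * N (t a) + E \<le> N (s a)" "Bd (s a) = wt a * wt b ^ m * Bd (t a)"
    "t b + (real m - 1) * (t b - s b) \<le> t a" "t a < t b + real m * (t b - s b)"
    using star_chain[where E = E, OF assms(1-3)] assms(5,6) by metis
  have mem: "a \<in> A" "b \<in> A" "s b \<le> s a" "s a < t b" using assms act_mem by auto
  define w v where "w = 1 / x a" and "v = t b - s b"
  have xb: "x b = 1 - x a" using act_sum[OF assms(1-3)] by simp
  have xa: "0 < x a" using x_pos mem by simp
  have v: "v = 1 / (1 - x a)" unfolding v_def using t_eq[OF mem(2)] xb by simp
  have "v > 0" unfolding v using assms(4) by simp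
  have wv: "w = (w - 1) * v" unfolding w_def v using xa assms(4) by (simp add: field_simps)
  have ta: "t a = s a + w" unfolding w_def using t_eq mem by simp
  have "(real m - 1) * v < w" using m(3) ta mem(4) unfolding v_def by simp
  then have "(real m - 1) * v < (w - 1) * v" using wv by simp
  then have 1: "real m < w" using \<open>v > 0\<close> by simp
  have "w < v + real m * v" using m(4) ta mem(3) unfolding v_def by simp
  then have "(w - 1) * v < (real m + 1) * v" using wv by (simp add: algebra_simps)
  then have 2: "w - 2 < real m" using \<open>v > 0\<close> by simp
  show thesis
    using that m(1,2) wt_star[OF mem(1,2) assms(4) xb, of m] 1 2 unfolding w_def by blast
qed

section \<open>Pairs of value one half\<close>

lemma half_pair:
  assumes "cut \<sigma>" "act \<sigma> a" "act \<sigma> b" "a \<noteq> b" "x a = 1 / 2"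
  shows "x b = 1 / 2" "s a = \<sigma>" "s b = \<sigma>" "t a = \<sigma> + 2" "t b = \<sigma> + 2" "cut (\<sigma> + 2)"
    "2 * N (\<sigma> + 2) \<le> N \<sigma>" "N (\<sigma> + 2) \<le> S \<sigma> a" "N (\<sigma> + 2) \<le> S \<sigma> b"
    "Bd \<sigma> = wt a * wt b * Bd (\<sigma> + 2)"
proof -
  show x: "x b = 1 / 2" using act_sum[OF assms(2-4)] assms(5) by simp
  show s: "s a = \<sigma>" "s b = \<sigma>" using cut_act_start assms by auto
  show t: "t a = \<sigma> + 2" "t b = \<sigma> + 2"
    using t_eq[of a] t_eq[of b] assms(2,3,5) x s act_mem by auto
  show "cut (\<sigma> + 2)" using tie_cut[OF assms(2-4)] t by simp
  show "2 * N (\<sigma> + 2) \<le> N \<sigma>" using N_branch[OF assms(2-4)] t by simp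
  show "N (\<sigma> + 2) \<le> S \<sigma> a" "N (\<sigma> + 2) \<le> S \<sigma> b"
    using N_end_le[OF assms(2)] N_end_le[OF assms(3)] t by auto
  show "Bd \<sigma> = wt a * wt b * Bd (\<sigma> + 2)" using Bd_tie[OF assms(2-4)] t by simp
qed

lemma half_pair_wt:
  assumes "act \<sigma> a" "act \<sigma> b" "a \<noteq> b" "x a = 1 / 2" "\<not> iso a"
  shows "wt a * wt b = \<beta>^2"
proof -
  have "x b = 1 / 2" using act_sum[OF assms(1-3)] assms(4) by simp
  moreover have "\<not> iso b" using iso_act(1)[OF assms(2,1)] assms(3,5) by auto
  ultimately have "wt a = \<beta>" "wt b = \<beta>" using assms act_mem by (auto intro!: wt_middle)
  then show ?thesis by (simp add: power2_eq_square)
qed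

text \<open>A pair of weight-two elements, not an isolated edge, that has no incomparability to its
  right: the missing factor \<open>\<beta>\<^sup>2 / 2\<close> is to be paid by its left neighbour.\<close>

definition debt :: "real \<Rightarrow> bool" where
  "debt \<sigma> \<longleftrightarrow> cut \<sigma> \<and> (\<exists>a b. act \<sigma> a \<and> act \<sigma> b \<and> a \<noteq> b \<and> x a = 1 / 2 \<and> \<not> iso a
    \<and> (\<forall>v. \<sigma> + 2 \<le> s v \<longrightarrow> \<not> inc a v \<and> \<not> inc b v))"

text \<open>The pair is not an isolated edge and sees nothing to its right, so one of its elements,
  the \<open>a\<close> obtained here, is incomparable to something ending by \<open>T\<close>;
  anything in between would be present beside the pair. \<open>left_cross\<close> moves this to an
  element \<open>c\<close> ending exactly at \<open>T\<close>, which is what lets the left neighbour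
  pay.\<close>

lemma debtE:
  assumes "debt T"
  obtains c a where "c \<in> A" "t c = T" "inc c a" "act T a" "s a = T" "x c \<le> 1 / 2"
    "2 * N (T + 2) \<le> N T" "N (T + 2) \<le> S T a" "Bd T = \<beta>^2 * Bd (T + 2)" "cut T"
proof -
  obtain a b where ab: "cut T" "act T a" "act T b" "a \<noteq> b" "x a = 1 / 2" "\<not> iso a"
    "\<And>v. T + 2 \<le> s v \<Longrightarrow> \<not> inc a v \<and> \<not> inc b v"
    using assms unfolding debt_def by blast
  note hp = half_pair[OF ab(1-5)]
  have "inc a b" by (rule act_inc[OF ab(2-4)])
  then obtain p v where pv: "p = a \<or> p = b" "inc p v" "v \<noteq> a" "v \<noteq> b"
    using ab(6) inc_sym inc_mem unfolding iso_def by metis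
  have p: "act T p" "s p = T" "t p = T + 2" "x p = 1 / 2" using pv(1) ab hp by auto
  have "t v \<le> T"
  proof (rule ccontr)
    assume "\<not> t v \<le> T"
    moreover have "\<not> T + 2 \<le> s v" using ab(7) pv(1,2) by blast
    ultimately have "act (max T (s v)) v" "act (max T (s v)) a" "act (max T (s v)) b"
      using pv(2) inc_mem s_less_t[of v] ab(2,3) hp by (auto simp: act_def max_def)
    then show False using act_only ab(4) pv(3,4) by metis
  qed
  then obtain c where c: "c \<in> A" "t c = T" "inc c p"
    using left_cross[OF ab(1) inc_sym[OF pv(2)]] p(2) by auto
  moreover have "x c \<le> 1 / 2" using inc_x[OF c(3)] p(4) by simp
  moreover have "N (T + 2) \<le> S T p" using pv(1) hp by auto
  moreover have "Bd T = \<beta>^2 * Bd (T + 2)"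
    using hp(10) half_pair_wt[OF ab(2-6)] by simp
  ultimately show thesis using that p hp(7) ab(1) by blast
qed

text \<open>Between two starts of elements with \<open>1 / 3 < x < 1 / 2\<close>, the values of \<open>N\<close> at the start and
  at the next end go from \<open>(Y, Z)\<close> to \<open>(2 Y + Z, Y + Z)\<close> or to \<open>(3 Y + Z, 2 Y + Z)\<close>, and two or three
  elements are gained; at a cut \<open>N\<close> is \<open>2 Y + Z\<close> and \<open>2 N + S\<close> is \<open>5 Y + 2 Z\<close>.\<close>

definition crossing_bound :: "real \<Rightarrow> real \<Rightarrow> real \<Rightarrow> bool" where
  "crossing_bound Y Z B \<longleftrightarrow> \<beta>^2 * B \<le> 2 * Y + Z \<and> \<beta>^3 * B \<le> 3 * Y + Z \<and> \<beta>^4 * B \<le> 5 * Y + 2 * Z"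

text \<open>The last inequality is what a weight-two pair ending at \<open>\<sigma>\<close> needs if one of its elements is
  incomparable to \<open>b\<close>.\<close>

definition boundary_claim :: "real \<Rightarrow> bool" where
  "boundary_claim \<sigma> \<longleftrightarrow> (if debt \<sigma> then Bd (\<sigma> + 2) \<le> N (\<sigma> + 2)
    else Bd \<sigma> \<le> N \<sigma> \<and> (\<forall>b. cut \<sigma> \<longrightarrow> act \<sigma> b \<longrightarrow> x b \<le> 1 / 2 \<longrightarrow> \<beta>^2 * Bd \<sigma> \<le> 2 * N \<sigma> + S \<sigma> b))"

text \<open>The induction visits two kinds of positions: boundaries, and starts of a value between
  \<open>1 / 3\<close> and \<open>1 / 2\<close> while its partner is already running. Each kind
  leads to the other, so both are proved together. \<open>\<sigma> \<le> L\<close> includes the end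
  of the tape, where nothing is left.\<close>

definition claim :: "real \<Rightarrow> bool" where
  "claim \<sigma> \<longleftrightarrow>
    (0 \<le> \<sigma> \<longrightarrow> \<sigma> \<le> L \<longrightarrow> cut \<sigma> \<or> (\<exists>a. act \<sigma> a \<and> s a = \<sigma> \<and> x a \<le> 1 / 3) \<longrightarrow> boundary_claim \<sigma>) \<and>
    (\<forall>a b. act \<sigma> a \<longrightarrow> s a = \<sigma> \<longrightarrow> 1 / 3 < x a \<longrightarrow> x a < 1 / 2 \<longrightarrow> act \<sigma> b \<longrightarrow> b \<noteq> a \<longrightarrow> s b < \<sigma>
      \<longrightarrow> crossing_bound (N \<sigma>) (N (t b)) (Bd \<sigma>))"

section \<open>Boundary positions of the induction\<close>

lemma claim_boundary:
  assumes "claim T" "a \<in> A" "t a = T" "cut T \<or> (\<exists>a. act T a \<and> s a = T \<and> x a \<le> 1 / 3)"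
  shows "boundary_claim T"
  using assms s_nonneg[of a] s_less_t[of a] t_le[of a] unfolding claim_def by auto

text \<open>The end \<open>T\<close> of \<open>a\<close> is a cut or the start of a successor with
  the same value, so the induction hypothesis applies there. Without a debt at \<open>T\<close> the
  star factor \<open>m + 1\<close> suffices. With a debt, the element from \<open>debtE\<close> is
  \<open>a\<close> itself, and the bonus from its incomparability across \<open>T\<close> repays
  \<open>\<beta>^2\<close>.\<close>

lemma boundary_star:
  assumes IH: "\<And>\<sigma>'. card (F \<sigma>') < card (F \<sigma>) \<Longrightarrow> claim \<sigma>'"
    and a: "act \<sigma> a" "s a = \<sigma>" "x a \<le> 1 / 3"
  shows "boundary_claim \<sigma>"
proof -
  define T where "T = t a"
  have aA: "a \<in> A" using a act_mem by simp
  obtain b where b: "act \<sigma> b" "b \<noteq> a" "x b = 1 - x a" using act_partner[OF a(1)] a(3) by auto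
  have "cut T \<or> (\<exists>a. act T a \<and> s a = T \<and> x a \<le> 1 / 3)"
    using next_start[OF aA] a(3) unfolding T_def by metis
  then have T: "boundary_claim T"
    using claim_boundary[OF IH[OF card_F_less[OF a(1) order_refl]] aA] unfolding T_def by blast
  have "\<not> debt \<sigma>"
  proof
    assume "debt \<sigma>"
    then obtain a' b' where "act \<sigma> a'" "act \<sigma> b'" "a' \<noteq> b'" "x a' = 1 / 2" unfolding debt_def by blast
    moreover from this have "x b' = 1 / 2" using act_sum by fastforce
    ultimately show False using act_only a(1,3) by fastforce
  qed
  have only: "b' = a" if "act \<sigma> b'" "x b' \<le> 1 / 2" for b'
    using act_only[OF a(1) b(1) b(2)[symmetric] that(1)] that(2) b(3) a(3) by auto
  have Sa: "N T \<le> S \<sigma> a" unfolding T_def by (rule N_end_le[OF a(1)])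
  have *: "Bd \<sigma> \<le> N \<sigma> \<and> \<beta>^2 * Bd \<sigma> \<le> 2 * N \<sigma> + N T"
  proof (cases "debt T")
    case True
    then obtain c a' where c: "c \<in> A" "t c = T" "inc c a'" "act T a'" "s a' = T" "x c \<le> 1 / 2"
      "2 * N (T + 2) \<le> N T" "N (T + 2) \<le> S T a'" "Bd T = \<beta>^2 * Bd (T + 2)" "cut T"
      by (rule debtE)
    \<comment> \<open>Two different elements ending at \<open>T\<close> overlap, so their values sum
      to \<open>1\<close>, impossible for \<open>x a \<le> 1 / 3\<close> and
      \<open>x c \<le> 1 / 2\<close>.\<close>
    have "c = a"
    proof (rule ccontr)
      assume "c \<noteq> a"
      have "s c < t a" "s a < t c" using c(1,2) aA s_less_t unfolding T_def by metis+
      from act_sum[OF overlap_act[OF c(1) aA this] \<open>c \<noteq> a\<close>] show False using a(3) c(6) by simp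
    qed
    have tie: "2 * N (t a) + S T a' \<le> N \<tau>" if "act \<tau> a" "act \<tau> b" "a \<noteq> b" "t b = t a" for \<tau> b
      using N_cross_branch[OF that] c(3-5) \<open>c = a\<close> unfolding T_def by blast
    obtain m where m: "(real m + 1) * N T + S T a' \<le> N \<sigma>" "Bd \<sigma> = wt a * wt b ^ m * Bd T"
      "\<beta>^2 * (wt a * wt b ^ m) \<le> 2 * real m + 3" "\<beta>^4 * (wt a * wt b ^ m) \<le> 4 * real m + 8"
      using star[OF act_start[OF aA], of b "S T a'"] a(2) b(1,2) a(3) tie c(10) unfolding T_def by metis
    \<comment> \<open>In units of \<open>X\<close>, \<open>N T\<close> is at least \<open>2\<close>
      and the bonus at least \<open>1\<close>. Hence \<open>N \<sigma>\<close> is at least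
      \<open>2 * m + 3\<close> and \<open>2 * N \<sigma> + N T\<close> at least
      \<open>4 * m + 8\<close>, matching \<open>wt_star\<close>.\<close>
    define X where "X = N (T + 2)"
    have X: "Bd (T + 2) \<le> X" "0 < X" using T True Bd_pos[of "T + 2"] unfolding boundary_claim_def X_def by auto
    have "(real m + 1) * (2 * X) \<le> (real m + 1) * N T" using c(7) unfolding X_def by (intro mult_left_mono) auto
    then have N: "(2 * real m + 3) * X \<le> N \<sigma>" using m(1) c(8) unfolding X_def by (simp add: algebra_simps)
    have "Bd \<sigma> = \<beta>^2 * (wt a * wt b ^ m) * Bd (T + 2)" using m(2) c(9) by simp
    also have "\<dots> \<le> (2 * real m + 3) * X" using m(3) X Bd_pos[of "T + 2"] by (intro mult_mono) auto
    finally have 1: "Bd \<sigma> \<le> N \<sigma>" using N by linarith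
    have "\<beta>^2 * Bd \<sigma> = \<beta>^4 * (wt a * wt b ^ m) * Bd (T + 2)"
      using m(2) c(9) by (simp add: power4_eq_xxxx power2_eq_square)
    also have "\<dots> \<le> (4 * real m + 8) * X" using m(4) X Bd_pos[of "T + 2"] by (intro mult_mono) auto
    also have "\<dots> \<le> 2 * N \<sigma> + N T" using N c(7) unfolding X_def by (simp add: algebra_simps)
    finally show ?thesis using 1 by blast
  next
    case False
    then have BT: "Bd T \<le> N T" "0 < N T" using T Bd_pos[of T] unfolding boundary_claim_def by auto
    have tie: "2 * N (t a) + 0 \<le> N \<tau>" if "act \<tau> a" "act \<tau> b" "a \<noteq> b" "t b = t a" for \<tau> b
      using N_branch[OF that(1-3)] that(4) by simp
    obtain m where m: "(real m + 1) * N T + 0 \<le> N \<sigma>" "Bd \<sigma> = wt a * wt b ^ m * Bd T"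
      "wt a * wt b ^ m \<le> real m + 1" "\<beta>^2 * (wt a * wt b ^ m) \<le> 2 * real m + 3"
      using star[OF act_start[OF aA], of b 0] a(2) b(1,2) a(3) tie unfolding T_def by metis
    have "Bd \<sigma> \<le> (real m + 1) * N T" unfolding m(2) using m(3) BT Bd_pos[of T] by (intro mult_mono) auto
    moreover have "\<beta>^2 * Bd \<sigma> \<le> (2 * real m + 3) * N T"
      unfolding m(2) using m(4) BT Bd_pos[of T] by (subst mult.assoc[symmetric], intro mult_mono) auto
    ultimately show ?thesis using m(1) by (simp add: algebra_simps)
  qed
  then show ?thesis unfolding boundary_claim_def using \<open>\<not> debt \<sigma>\<close> only Sa by force
qed

text \<open>An element of value \<open>1\<close> is comparable to all others and has weight
  \<open>1\<close>. No debt can start at its end, since the element from \<open>debtE\<close> would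
  be present together with it.\<close>

lemma boundary_single:
  assumes IH: "\<And>\<sigma>'. card (F \<sigma>') < card (F \<sigma>) \<Longrightarrow> claim \<sigma>'"
    and u: "cut \<sigma>" "act \<sigma> u" "x u = 1"
  shows "boundary_claim \<sigma>"
proof -
  have uA: "u \<in> A" using u act_mem by simp
  have not_inc_u: "\<not> inc u v" for v using x_less_one u(3) by force
  have only: "v = u" if "act \<sigma> v" for v using act_inc[OF u(2) that] not_inc_u by auto
  have "boundary_claim (t u)"
    using claim_boundary[OF IH[OF card_F_less[OF u(2) order_refl]] uA] single_cut[OF u(2,3)] by blast
  moreover have "\<not> debt (t u)"
  proof
    assume "debt (t u)"
    then obtain c a where c: "c \<in> A" "t c = t u" "inc c a" by (rule debtE)
    then have "c \<noteq> u" using not_inc_u by auto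
    have "s c < t u" "s u < t c" using c uA s_less_t by metis+
    from act_inc[OF overlap_act[OF c(1) uA this] \<open>c \<noteq> u\<close>] show False using not_inc_u inc_sym by blast
  qed
  ultimately have "Bd (t u) \<le> N (t u)" unfolding boundary_claim_def by simp
  moreover have "Bd \<sigma> = Bd (t u)"
  proof -
    have "t u < t v" if "v \<in> F \<sigma>" "v \<noteq> u" for v
    proof (rule ccontr)
      assume "\<not> t u < t v"
      then have "act (max \<sigma> (s v)) v" "act (max \<sigma> (s v)) u"
        using that u s_less_t[of v] by (auto simp: F_def act_def max_def)
      then show False using act_inc not_inc_u that(2) by metis
    qed
    then have "F \<sigma> = insert u (F (t u))" using u(2) by (auto simp: F_def act_def)
    moreover have "u \<notin> F (t u)" by (simp add: F_def)
    ultimately show ?thesis unfolding Bd_def using finite_F wt_single[OF uA u(3)] by simp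
  qed
  moreover have "N (t u) \<le> N \<sigma>" using u(2) by (intro N_mono) (simp add: act_def)
  moreover have "\<not> debt \<sigma>" unfolding debt_def using only by metis
  ultimately show ?thesis unfolding boundary_claim_def using only u(3) by force
qed

lemma debt_S:
  assumes "debt T" "act T c"
  shows "N (T + 2) \<le> S T c"
proof -
  obtain a b where ab: "cut T" "act T a" "act T b" "a \<noteq> b" "x a = 1 / 2"
    using assms(1) unfolding debt_def by blast
  then show ?thesis using half_pair(8,9)[OF ab] act_only[OF ab(2-4) assms(2)] by auto
qed

text \<open>An isolated edge has weight exactly the \<open>2\<close> that branching gives. A pair in
  debt only passes on the claim at its end, where no further debt starts because the pair has no
  incomparability to its right. Any other pair is incomparable to an element starting at its end,
  and \<open>N_cross_branch\<close> pays for it.\<close>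

lemma boundary_half:
  assumes IH: "\<And>\<sigma>'. card (F \<sigma>') < card (F \<sigma>) \<Longrightarrow> claim \<sigma>'"
    and ab: "cut \<sigma>" "act \<sigma> a" "act \<sigma> b" "a \<noteq> b" "x a = 1 / 2"
  shows "boundary_claim \<sigma>"
proof -
  define T where "T = \<sigma> + 2"
  note hp = half_pair[OF ab, folded T_def]
  have aA: "a \<in> A" using ab act_mem by simp
  have only: "c = a \<or> c = b" if "act \<sigma> c" for c using act_only[OF ab(2-4) that] .
  have T: "boundary_claim T"
    using claim_boundary[OF IH[OF card_F_less[OF ab(2) order_refl]] aA] hp by metis
  have ends: "c = a \<or> c = b" if "c \<in> A" "t c = T" for c
  proof -
    have "act (max \<sigma> (s c)) c" "act (max \<sigma> (s c)) a" "act (max \<sigma> (s c)) b"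
      using that s_less_t[of c] ab(2,3) hp T_def by (auto simp: act_def max_def)
    then show ?thesis using act_only ab(4) by metis
  qed
  have S: "N T \<le> S \<sigma> c" if "act \<sigma> c" for c using only[OF that] hp by auto
  show ?thesis
  proof (cases "iso a")
    case True
    note isa = iso_act[OF ab(2-4) True]
    have "\<not> debt T"
    proof
      assume "debt T"
      then obtain c a' where c: "c \<in> A" "t c = T" "inc c a'" "s a' = T" by (rule debtE)
      then have "a' = a \<or> a' = b" using ends isa by metis
      then show False using c(4) hp(2,3) T_def by auto
    qed
    then have NT: "Bd T \<le> N T" using T unfolding boundary_claim_def by simp
    have "wt a * wt b = 2" using wt_iso[OF True] wt_iso[OF isa(1)] by simp
    then have Bd: "Bd \<sigma> = 2 * Bd T" using hp(10) by simp
    have "\<not> debt \<sigma>" using only True isa(1) unfolding debt_def by metis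
    moreover have "\<beta>^2 * Bd \<sigma> \<le> 2 * N \<sigma> + S \<sigma> c" if "act \<sigma> c" for c
    proof -
      have "\<beta>^2 * Bd \<sigma> \<le> (223 / 100) * (2 * N T)"
        unfolding Bd using \<beta>_power_2 NT Bd_pos[of T] by (intro mult_mono) auto
      then show ?thesis using S[OF that] hp(7) NT Bd_pos[of T] by linarith
    qed
    ultimately show ?thesis unfolding boundary_claim_def using Bd NT hp(7) by auto
  next
    case False
    have Bd: "Bd \<sigma> = \<beta>^2 * Bd T" using half_pair_wt[OF ab(2-5) False] hp(10) by simp
    show ?thesis
    proof (cases "debt \<sigma>")
      case True
      then obtain a1 b1 where a1: "act \<sigma> a1" "act \<sigma> b1" "a1 \<noteq> b1"
        "\<And>v. T \<le> s v \<Longrightarrow> \<not> inc a1 v \<and> \<not> inc b1 v"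
        unfolding debt_def T_def by blast
      have "\<not> debt T"
      proof
        assume "debt T"
        then obtain c a' where c: "c \<in> A" "t c = T" "inc c a'" "s a' = T" by (rule debtE)
        moreover have "c = a1 \<or> c = b1" using ends[OF c(1,2)] only[OF a1(1)] only[OF a1(2)] a1(3) by auto
        ultimately show False using a1(4)[of a'] by auto
      qed
      then show ?thesis using T True unfolding boundary_claim_def T_def by simp
    next
      case nd: False
      then obtain v where v: "T \<le> s v" "inc a v \<or> inc b v"
        using ab False unfolding debt_def T_def by blast
      then obtain p q where pq: "act \<sigma> p" "act \<sigma> q" "p \<noteq> q" "t p = T" "t q = T" "inc p v" "x p = 1 / 2"
        using ab hp by metis
      obtain c where c: "act T c" "s c = T" "inc p c"
        using right_cross[OF hp(6) pq(6)] pq(4) v(1) by auto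
      have xc: "x c \<le> 1 / 2" using inc_x[OF c(3)] pq(7) by simp
      have N: "2 * N T + S T c \<le> N \<sigma>"
        using N_cross_branch[OF pq(1-3)] pq(4,5) c by metis
      have "Bd \<sigma> \<le> N \<sigma> \<and> \<beta>^2 * Bd \<sigma> \<le> 2 * N \<sigma> + N T"
      proof (cases "debt T")
        case True
        \<comment> \<open>In units of \<open>X\<close>, \<open>N \<sigma>\<close> is at least
          \<open>2 * 2 + 1 = 5\<close> and \<open>2 * N \<sigma> + N T\<close> at least
          \<open>12\<close>, against \<open>\<beta>^4 \<le> 5\<close> and
          \<open>\<beta>^6 \<le> 11\<close>.\<close>
        define X where "X = N (T + 2)"
        have X: "Bd (T + 2) \<le> X" "0 < X"
          using T True Bd_pos[of "T + 2"] unfolding boundary_claim_def X_def by auto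
        have NT: "2 * X \<le> N T" "Bd T = \<beta>^2 * Bd (T + 2)"
          using debtE[OF True] unfolding X_def by metis+
        have "X \<le> S T c" unfolding X_def by (rule debt_S[OF True c(1)])
        then have 5: "5 * X \<le> N \<sigma>" using N NT by linarith
        have "Bd \<sigma> = \<beta>^4 * Bd (T + 2)" unfolding Bd NT(2) by (simp add: power4_eq_xxxx power2_eq_square)
        also have "\<dots> \<le> 5 * X" using \<beta>_power_4 X Bd_pos[of "T + 2"] by (intro mult_mono) auto
        finally have 1: "Bd \<sigma> \<le> N \<sigma>" using 5 by linarith
        have "\<beta>^2 * Bd \<sigma> = \<beta>^6 * Bd (T + 2)"
          unfolding Bd NT(2) by (simp flip: power_add mult.assoc)
        also have "\<dots> \<le> 11 * X" using \<beta>_power_6 X Bd_pos[of "T + 2"] by (intro mult_mono) auto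
        finally show ?thesis using 1 5 NT X(2) by linarith
      next
        case False
        \<comment> \<open>The stronger inequality at \<open>T\<close> applies to \<open>c\<close>
          because \<open>x c \<le> 1 / 2\<close>, and is exactly what the pair ending at
          \<open>T\<close> needs.\<close>
        then have NT: "Bd T \<le> N T" "\<beta>^2 * Bd T \<le> 2 * N T + S T c"
          using T hp(6) c(1) xc unfolding boundary_claim_def by auto
        then have 1: "Bd \<sigma> \<le> N \<sigma>" using N Bd by linarith
        have "\<beta>^2 * Bd \<sigma> \<le> (223 / 100) * Bd \<sigma>"
          using \<beta>_power_2 Bd_pos[of \<sigma>] by (intro mult_right_mono) auto
        moreover have "Bd \<sigma> \<le> (223 / 100) * Bd T"
          unfolding Bd using \<beta>_power_2 Bd_pos[of T] by (intro mult_right_mono) auto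
        ultimately show ?thesis using 1 NT(1) Bd_pos[of T] by argo
      qed
      then show ?thesis unfolding boundary_claim_def using nd S by force
    qed
  qed
qed

section \<open>Crossing positions of the induction\<close>

lemma crossing_bound_mono: "crossing_bound Y Z B \<Longrightarrow> Y \<le> Y' \<Longrightarrow> Z \<le> Z' \<Longrightarrow> crossing_bound Y' Z' B"
  unfolding crossing_bound_def by linarith

text \<open>The new first inequality follows from the old third one; the other two follow from the
  old first one and the bounds on \<open>\<beta>^3\<close> and \<open>\<beta>^4\<close>.\<close>

lemma crossing_two:
  assumes "crossing_bound Y Z B" "0 \<le> Y" "0 \<le> Z" "0 \<le> B"
  shows "crossing_bound (2 * Y + Z) (Y + Z) (\<beta>^2 * B)"
proof -
  have B: "\<beta>^2 * B \<le> 2 * Y + Z" "\<beta>^4 * B \<le> 5 * Y + 2 * Z" "0 \<le> \<beta>^2 * B"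
    using assms(1,4) unfolding crossing_bound_def by auto
  have "\<beta>^3 * (\<beta>^2 * B) \<le> (10 / 3) * (2 * Y + Z)"
    by (rule mult_mono[OF \<beta>_power_3 B(1) _ B(3)]) simp
  moreover have "\<beta>^4 * (\<beta>^2 * B) \<le> 5 * (2 * Y + Z)"
    by (rule mult_mono[OF \<beta>_power_4 B(1) _ B(3)]) simp
  moreover have "\<beta>^2 * (\<beta>^2 * B) = \<beta>^4 * B" by (simp flip: power_add mult.assoc)
  ultimately show ?thesis using B(2) assms(2,3) unfolding crossing_bound_def by argo
qed

lemma crossing_three:
  assumes "crossing_bound Y Z B" "0 \<le> Y" "0 \<le> Z" "0 \<le> B"
  shows "crossing_bound (3 * Y + Z) (2 * Y + Z) (\<beta>^3 * B)"
proof -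
  have B: "\<beta>^3 * B \<le> 3 * Y + Z" "0 \<le> \<beta>^3 * B"
    using assms(1,4) \<beta>_ge_1 unfolding crossing_bound_def by auto
  have "\<beta>^2 * (\<beta>^3 * B) \<le> (223 / 100) * (3 * Y + Z)"
    by (rule mult_mono[OF \<beta>_power_2 B(1) _ B(2)]) simp
  moreover have "\<beta>^3 * (\<beta>^3 * B) \<le> (10 / 3) * (3 * Y + Z)"
    by (rule mult_mono[OF \<beta>_power_3 B(1) _ B(2)]) simp
  moreover have "\<beta>^4 * (\<beta>^3 * B) \<le> 5 * (3 * Y + Z)"
    by (rule mult_mono[OF \<beta>_power_4 B(1) _ B(2)]) simp
  ultimately show ?thesis using assms(2,3) unfolding crossing_bound_def by argo
qed

text \<open>Initial values when \<open>a\<close> and its second partner end together at a cut with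
  count at least \<open>X\<close>: three elements are gained, and branching gives
  \<open>2 * X\<close> and then \<open>3 * X\<close>.\<close>

lemma crossing_tie:
  assumes "0 < B" "B \<le> X"
  shows "crossing_bound (3 * X) (2 * X) (\<beta>^3 * B)"
proof -
  have "\<beta>^5 * B \<le> 8 * X" "\<beta>^6 * B \<le> 11 * X" "\<beta>^7 * B \<le> 19 * X"
    using assms \<beta>_power_5 \<beta>_power_6 \<beta>_power_7 by (intro mult_mono; simp)+
  then show ?thesis using assms unfolding crossing_bound_def by (auto simp flip: power_add mult.assoc)
qed

text \<open>The same with a debt at the cut, whose pair adds two elements. With \<open>X\<close> the
  count after that pair, the count at the cut is at least \<open>2 * X\<close>, and the bonus
  \<open>X\<close> leads to \<open>5 * X\<close> and then \<open>7 * X\<close>.\<close>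

lemma crossing_tie_debt:
  assumes "0 < B" "B \<le> X"
  shows "crossing_bound (7 * X) (5 * X) (\<beta>^5 * B)"
proof -
  have "\<beta>^7 * B \<le> 19 * X" "\<beta>^8 * B \<le> 26 * X" "\<beta>^9 * B \<le> 45 * X"
    using assms \<beta>_power_7 \<beta>_power_8 \<beta>_power_9 by (intro mult_mono; simp)+
  then show ?thesis using assms unfolding crossing_bound_def by (auto simp flip: power_add mult.assoc)
qed

lemma N_nonneg: "0 \<le> N \<tau>"
  by (simp add: N_def)

text \<open>Partners are shorter than \<open>a\<close> but longer than half of it, which limits how
  many can end while \<open>a\<close> is present.\<close>

lemma middle_facts:
  assumes "act \<tau> a" "act \<tau> b" "a \<noteq> b" "1 / 3 < x a" "x a < 1 / 2"
  shows "wt a = \<beta>" "wt b = \<beta>" "t b - s b < t a - s a" "t a - s a < 2 * (t b - s b)" "1 / 2 < x b"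
proof -
  have xb: "x b = 1 - x a" using act_sum[OF assms(1-3)] by simp
  have mem: "a \<in> A" "b \<in> A" using assms act_mem by auto
  have "\<not> iso a" "\<not> iso b" using iso_half[of a] iso_half[of b] xb assms(5) by auto
  then show "wt a = \<beta>" "wt b = \<beta>" using mem xb assms(4,5) by (auto intro!: wt_middle)
  have "0 < x a" "0 < 1 - x a" using assms(4,5) by auto
  then have "1 / (1 - x a) < 1 / x a" "1 / x a < 2 * (1 / (1 - x a))"
    using assms(4,5) by (simp_all add: field_simps)
  then show "t b - s b < t a - s a" "t a - s a < 2 * (t b - s b)"
    using t_eq[OF mem(1)] t_eq[OF mem(2)] xb by simp_all
  show "1 / 2 < x b" using xb assms(5) by simp
qed

text \<open>If \<open>b\<close> outlives \<open>a\<close>, the successor of \<open>a\<close> starts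
  at \<open>t a\<close> while \<open>b\<close> is running. This is the next crossing position, and
  the induction hypothesis applies there.\<close>

lemma middle_last:
  assumes IH: "\<And>\<sigma>'. card (F \<sigma>') < card (F \<sigma>) \<Longrightarrow> claim \<sigma>'" and "card (F \<tau>) \<le> card (F \<sigma>)"
    and ab: "act \<tau> a" "act \<tau> b" "a \<noteq> b" "1 / 3 < x a" "x a < 1 / 2" "t a < t b"
  shows "crossing_bound (N (t a)) (N (t b)) (Bd (t a))" "N (t a) + N (t b) \<le> N \<tau>" "Bd \<tau> = \<beta> * Bd (t a)"
proof -
  obtain a' where a': "act (t a) a'" "a' \<noteq> b" "s a' = t a" "x a' = x a" "act (t a) b"
    using next_partner[OF ab(2,1) ab(3)[symmetric] ab(6)] by blast
  have "s b < t a" using ab(1,2) by (auto simp: act_def)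
  moreover have "claim (t a)" using IH assms(2) card_F_less[OF ab(1) order_refl] by simp
  ultimately show "crossing_bound (N (t a)) (N (t b)) (Bd (t a))"
    using a' ab(4,5) unfolding claim_def by metis
  show "N (t a) + N (t b) \<le> N \<tau>" by (rule N_branch[OF ab(1-3)])
  show "Bd \<tau> = \<beta> * Bd (t a)"
    using Bd_step[OF ab(2,1) ab(3)[symmetric] ab(6)] middle_facts(1)[OF ab(1-5)] by simp
qed

text \<open>The partner after \<open>b\<close> ends together with \<open>a\<close>, after it, or
  before it. In the last case the following partner outlives \<open>a\<close>, since two partner
  lengths exceed that of \<open>a\<close>. The cases are settled by \<open>crossing_tie\<close> or
  \<open>crossing_tie_debt\<close>, by \<open>crossing_two\<close>, and by
  \<open>crossing_three\<close>.\<close>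

lemma middle_crossing:
  assumes IH: "\<And>\<sigma>'. card (F \<sigma>') < card (F \<sigma>) \<Longrightarrow> claim \<sigma>'"
    and ab: "act \<sigma> a" "act \<sigma> b" "a \<noteq> b" "1 / 3 < x a" "x a < 1 / 2" "s a = \<sigma>" "s b < \<sigma>"
  shows "crossing_bound (N \<sigma>) (N (t b)) (Bd \<sigma>)"
proof -
  have aA: "a \<in> A" using ab act_mem by simp
  note mf = middle_facts[OF ab(1-5)]
  have "t b < t a" using mf(3) ab(6,7) by linarith
  have N\<sigma>: "N (t a) + N (t b) \<le> N \<sigma>" by (rule N_branch[OF ab(1-3)])
  have B\<sigma>: "Bd \<sigma> = \<beta> * Bd (t b)" using Bd_step[OF ab(1-3) \<open>t b < t a\<close>] mf by simp
  obtain b2 where b2: "act (t b) b2" "b2 \<noteq> a" "s b2 = t b" "act (t b) a" "t b2 - s b2 = t b - s b"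
    using next_partner[OF ab(1-3) \<open>t b < t a\<close>] by metis
  note mf2 = middle_facts[OF b2(4,1) b2(2)[symmetric] ab(4,5)]
  have card_b: "card (F (t b)) \<le> card (F \<sigma>)" using card_F_less[OF ab(2) order_refl] by simp
  consider "t b2 = t a" | "t a < t b2" | "t b2 < t a" by linarith
  then show ?thesis
  proof cases
    case 1
    define T where "T = t a"
    note tie = b2(4,1) b2(2)[symmetric] 1
    have "Bd (t b) = \<beta>^2 * Bd T"
      using Bd_tie[OF tie] mf(1) mf2(2) unfolding T_def by (simp add: power2_eq_square)
    then have B: "Bd \<sigma> = \<beta>^3 * Bd T" using B\<sigma> by (simp add: power3_eq_cube power2_eq_square)
    have "cut T" unfolding T_def by (rule tie_cut[OF tie])
    then have T: "boundary_claim T"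
      using claim_boundary[OF IH[OF card_F_less[OF ab(1) order_refl]] aA] unfolding T_def by blast
    show ?thesis
    proof (cases "debt T")
      case True
      then obtain c a' where c: "c \<in> A" "t c = T" "inc c a'" "act T a'" "s a' = T" "x c \<le> 1 / 2"
        "2 * N (T + 2) \<le> N T" "N (T + 2) \<le> S T a'" "Bd T = \<beta>^2 * Bd (T + 2)"
        by (rule debtE)
      have "c = a"
      proof (rule ccontr)
        assume "c \<noteq> a"
        have "s c < t a" "s a < t c" using c(1,2) aA s_less_t unfolding T_def by metis+
        from act_sum[OF overlap_act[OF c(1) aA this] \<open>c \<noteq> a\<close>] show False using ab(5) c(6) by simp
      qed
      then have "2 * N T + S T a' \<le> N (t b)"
        using N_cross_branch[OF tie] c(3-5) unfolding T_def by blast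
      then have "5 * N (T + 2) \<le> N (t b)" "7 * N (T + 2) \<le> N \<sigma>"
        using c(7,8) N\<sigma> unfolding T_def by linarith+
      moreover have "crossing_bound (7 * N (T + 2)) (5 * N (T + 2)) (\<beta>^5 * Bd (T + 2))"
        using T True Bd_pos unfolding boundary_claim_def by (intro crossing_tie_debt) auto
      moreover have "Bd \<sigma> = \<beta>^5 * Bd (T + 2)" unfolding B c(9) by (simp flip: power_add mult.assoc)
      ultimately show ?thesis using crossing_bound_mono by metis
    next
      case False
      have "2 * N T \<le> N (t b)" using N_branch[OF tie(1-3)] 1 unfolding T_def by simp
      moreover from this have "3 * N T \<le> N \<sigma>" using N\<sigma> unfolding T_def by linarith
      moreover have "crossing_bound (3 * N T) (2 * N T) (\<beta>^3 * Bd T)"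
        using T False Bd_pos unfolding boundary_claim_def by (intro crossing_tie) auto
      ultimately show ?thesis unfolding B using crossing_bound_mono by metis
    qed
  next
    case 2
    note l = middle_last[OF IH card_b b2(4,1) b2(2)[symmetric] ab(4,5) 2]
    have "Bd \<sigma> = \<beta>^2 * Bd (t a)" using B\<sigma> l(3) by (simp add: power2_eq_square)
    then show ?thesis
      using crossing_bound_mono[OF crossing_two[OF l(1) N_nonneg N_nonneg less_imp_le[OF Bd_pos]] _ l(2)] l(2) N\<sigma> by simp
  next
    case 3
    obtain b3 where b3: "act (t b2) b3" "b3 \<noteq> a" "s b3 = t b2" "act (t b2) a" "t b3 - s b3 = t b2 - s b2"
      using next_partner[OF b2(4,1) b2(2)[symmetric] 3] by metis
    have "t b3 = t b + 2 * (t b - s b)" using b3 b2 by simp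
    then have "t a < t b3" using mf(4) ab(2,6) act_mem[of \<sigma> b] by simp
    moreover have "card (F (t b2)) \<le> card (F \<sigma>)" using card_F_less[OF b2(1) order_refl] card_b by simp
    ultimately have l: "crossing_bound (N (t a)) (N (t b3)) (Bd (t a))" "N (t a) + N (t b3) \<le> N (t b2)"
      "Bd (t b2) = \<beta> * Bd (t a)"
      using middle_last[OF IH _ b3(4,1) b3(2)[symmetric] ab(4,5)] by blast+
    have "N (t a) + N (t b2) \<le> N (t b)" by (rule N_branch[OF b2(4,1) b2(2)[symmetric]])
    then have n: "2 * N (t a) + N (t b3) \<le> N (t b)" "3 * N (t a) + N (t b3) \<le> N \<sigma>" using l(2) N\<sigma> by simp_all
    have "Bd \<sigma> = \<beta>^3 * Bd (t a)"
      using B\<sigma> l(3) Bd_step[OF b2(4,1) b2(2)[symmetric] 3] mf2(2) by (simp add: power3_eq_cube)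
    then show ?thesis using crossing_bound_mono[OF crossing_three[OF l(1) N_nonneg N_nonneg less_imp_le[OF Bd_pos]] n(2,1)] by simp
  qed
qed

text \<open>At a cut both elements start together, so \<open>b\<close> ends first and its successor
  outlives \<open>a\<close>. This leads to a crossing position at \<open>t a\<close>. Since
  \<open>x b > 1 / 2\<close>, the stronger inequality concerns only \<open>a\<close>.\<close>

lemma boundary_middle:
  assumes IH: "\<And>\<sigma>'. card (F \<sigma>') < card (F \<sigma>) \<Longrightarrow> claim \<sigma>'"
    and ab: "cut \<sigma>" "act \<sigma> a" "act \<sigma> b" "a \<noteq> b" "1 / 3 < x a" "x a < 1 / 2"
  shows "boundary_claim \<sigma>"
proof -
  note mf = middle_facts[OF ab(2-6)]
  have s: "s a = \<sigma>" "s b = \<sigma>" using cut_act_start[OF ab(1)] ab by auto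
  have "t b < t a" using mf(3) s by linarith
  obtain b2 where b2: "act (t b) b2" "b2 \<noteq> a" "s b2 = t b" "act (t b) a" "t b2 - s b2 = t b - s b"
    using next_partner[OF ab(2-4) \<open>t b < t a\<close>] by metis
  have "t a < t b2" using mf(4) b2 s by simp
  moreover have card_b: "card (F (t b)) \<le> card (F \<sigma>)" using card_F_less[OF ab(3) order_refl] by simp
  ultimately have l: "crossing_bound (N (t a)) (N (t b2)) (Bd (t a))" "N (t a) + N (t b2) \<le> N (t b)"
      "Bd (t b) = \<beta> * Bd (t a)"
    using middle_last[OF IH _ b2(4,1) b2(2)[symmetric] ab(5,6)] by blast+
  have N: "2 * N (t a) + N (t b2) \<le> N \<sigma>" using N_branch[OF ab(2-4)] l(2) by simp
  have Bd: "Bd \<sigma> = \<beta>^2 * Bd (t a)"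
    using Bd_step[OF ab(2-4) \<open>t b < t a\<close>] mf(2) l(3) by (simp add: power2_eq_square)
  have "\<beta>^2 * Bd \<sigma> = \<beta>^4 * Bd (t a)" unfolding Bd by (simp flip: power_add mult.assoc)
  then have "Bd \<sigma> \<le> N \<sigma>" "\<beta>^2 * Bd \<sigma> \<le> 2 * N \<sigma> + N (t a)"
    using l(1) N N_nonneg[of "t a"] N_nonneg[of "t b2"] unfolding crossing_bound_def Bd by linarith+
  moreover have "N (t a) \<le> S \<sigma> a" by (rule N_end_le[OF ab(2)])
  moreover have only: "c = a \<or> c = b" if "act \<sigma> c" for c by (rule act_only[OF ab(2-4) that])
  moreover have "\<not> debt \<sigma>"
  proof
    assume "debt \<sigma>"
    then obtain a' where "act \<sigma> a'" "x a' = 1 / 2" unfolding debt_def by blast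
    then show False using only ab(6) mf(5) by force
  qed
  ultimately show ?thesis unfolding boundary_claim_def using mf(5) by force
qed

section \<open>Conclusion of the induction\<close>

lemma claim_holds: "claim \<sigma>"
proof (induction "card (F \<sigma>)" arbitrary: \<sigma> rule: less_induct)
  case less
  have "boundary_claim \<sigma>"
    if \<sigma>: "0 \<le> \<sigma>" "\<sigma> \<le> L" "cut \<sigma> \<or> (\<exists>a. act \<sigma> a \<and> s a = \<sigma> \<and> x a \<le> 1 / 3)"
  proof (cases "\<exists>a. act \<sigma> a \<and> s a = \<sigma> \<and> x a \<le> 1 / 3")
    case True
    then show ?thesis using boundary_star less by blast
  next
    case False
    then have cut: "cut \<sigma>" using \<sigma> by blast
    show ?thesis
    proof (cases "\<sigma> = L")
      case True
      then have "F \<sigma> = {}" using t_le unfolding F_def by force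
      moreover from this have "\<not> act \<sigma> v" for v unfolding F_def act_def by blast
      ultimately show ?thesis by (simp add: boundary_claim_def debt_def N_def Bd_def ext_count_empty)
    next
      case False
      then have "\<sigma> < L" using \<sigma> by simp
      with \<sigma>(1) show ?thesis
      proof (cases rule: act_cases)
        case (single u)
        then show ?thesis using boundary_single[OF less cut] by blast
      next
        case (double u v)
        then have "x u + x v = 1" by (rule act_sum)
        then have "x u \<le> 1 / 2 \<or> x v \<le> 1 / 2" by linarith
        then obtain a b where ab: "act \<sigma> a" "act \<sigma> b" "a \<noteq> b" "x a \<le> 1 / 2"
          using double by metis
        then have "1 / 3 < x a"
          using \<open>\<not> (\<exists>a. act \<sigma> a \<and> s a = \<sigma> \<and> x a \<le> 1 / 3)\<close> cut_act_start[OF cut] by force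
        then show ?thesis
          using boundary_half[OF less cut ab(1-3)] boundary_middle[OF less cut ab(1-3)] ab(4) by force
      qed
    qed
  qed
  moreover have "crossing_bound (N \<sigma>) (N (t b)) (Bd \<sigma>)"
    if "act \<sigma> a" "s a = \<sigma>" "1 / 3 < x a" "x a < 1 / 2" "act \<sigma> b" "b \<noteq> a" "s b < \<sigma>" for a b
    using middle_crossing[OF less] that by blast
  ultimately show ?case unfolding claim_def by blast
qed

text \<open>Nothing has ended at \<open>0\<close>, so \<open>F 0\<close> is the whole poset. It is a
  cut, and a debt there would need an element ending at \<open>0\<close>.\<close>

theorem prod_wt_le: "prod wt A \<le> real (ext_count r A)"
proof (cases "A = {}")
  case True
  then show ?thesis by (simp add: ext_count_empty)
next
  case False
  have pos: "0 < t v" if "v \<in> A" for v using s_nonneg s_less_t that by fastforce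
  then have F0: "F 0 = A" by (auto simp: F_def)
  have "0 \<le> L" using False pos t_le by force
  moreover have "cut 0" unfolding cut_def using s_nonneg by force
  ultimately have "boundary_claim 0" using claim_holds[of 0] unfolding claim_def by simp
  moreover have "\<not> debt 0" using debtE[of 0] pos by (metis less_irrefl)
  ultimately show ?thesis unfolding boundary_claim_def Bd_def N_def F0 by simp
qed

end

section \<open>Numerical bounds and rounding\<close>

text \<open>\<open>2 ^ 19 = 524288\<close> lies just below \<open>3 ^ 12 = 531441\<close>. This
  yields \<open>c \<ge> 3 - 24 / 19 = 33 / 19\<close>.\<close>

lemma log_2_3_ge: "19 / 12 \<le> log 2 (3 :: real)"
proof -
  have "log 2 (2 ^ 19) \<le> log 2 ((3 :: real) ^ 12)" by (subst log_le_cancel_iff) auto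
  moreover have "log 2 ((2 :: real) ^ 19) = 19" "log 2 ((3 :: real) ^ 12) = 12 * log 2 3"
    by (subst log_nat_power; simp)+
  ultimately show ?thesis by linarith
qed

text \<open>Replaces the irrational exponent \<open>1 / c\<close> by \<open>19 / 33\<close>, so that
  concrete cases become inequalities between integer powers.\<close>

lemma powr_inverse_le:
  fixes c q V :: real
  assumes "33 / 19 \<le> c" "1 \<le> q" "0 < V" "V ^ 19 \<le> q ^ 33"
  shows "V powr (1 / c) \<le> q"
proof -
  have "ln (V ^ 19) \<le> ln (q ^ 33)" using assms by (subst ln_le_cancel_iff) auto
  then have "19 * ln V \<le> 33 * ln q" using assms by (simp add: ln_realpow)
  moreover have "(33 / 19) * ln q \<le> c * ln q" using assms by (intro mult_right_mono) auto
  ultimately have "ln V \<le> c * ln q" by simp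
  then have "(1 / c) * ln V \<le> ln q" using assms(1) by (simp add: field_simps)
  then have "exp ((1 / c) * ln V) \<le> exp (ln q)" by simp
  then show ?thesis using assms by (simp add: powr_def)
qed

text \<open>Version for unbounded families: the surplus exponent \<open>33 - 19 = 14\<close> absorbs
  the constant \<open>d\<close>, checked once at a lower bound \<open>q0\<close> for
  \<open>q\<close>.\<close>

lemma powr_inverse_le':
  fixes c q V d :: real and q0 :: nat
  assumes "33 / 19 \<le> c" "1 \<le> q" "0 < V" "V \<le> d * q" "0 < d" "d ^ 19 \<le> real q0 ^ 14" "real q0 \<le> q"
  shows "V powr (1 / c) \<le> q"
proof (rule powr_inverse_le[OF assms(1-3)])
  have "V ^ 19 \<le> (d * q) ^ 19" using assms by (intro power_mono) auto
  also have "\<dots> = d ^ 19 * q ^ 19" by (simp add: power_mult_distrib)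
  also have "\<dots> \<le> real q0 ^ 14 * q ^ 19" using assms by (intro mult_right_mono) auto
  also have "\<dots> \<le> q ^ 14 * q ^ 19" using assms by (intro mult_right_mono power_mono) auto
  also have "\<dots> = q ^ 33" by (simp flip: power_add)
  finally show "V ^ 19 \<le> q ^ 33" .
qed

lemma one_plus_inverse_power_le:
  assumes "0 < k"
  shows "(real (Suc k) / real k) ^ k \<le> 272 / 100"
proof -
  have "(real (Suc k) / real k) ^ k \<le> exp (1 / real k) ^ k"
    using exp_ge_add_one_self[of "1 / real k"] assms
    by (intro power_mono) (auto simp: field_simps)
  also have "\<dots> = exp 1" using assms by (simp flip: exp_of_nat_mult)
  also have "\<dots> \<le> 272 / 100" using e_less_272 by simp
  finally show ?thesis .
qed

text \<open>Rests on \<open>(1 + 1 / k) ^ k \<le> e\<close>. For \<open>m = K = k + 1\<close> the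
  remaining factor is \<open>(k + 1)^2 / k = m + 1 + 1 / k\<close>, and \<open>k \<ge> 4\<close>
  gives the \<open>5 / 4\<close>.\<close>

lemma star_weight_large:
  assumes "5 \<le> m" "m = K - 1 \<or> m = K"
  shows "real K * (real K / (real K - 1)) ^ m \<le> 272 / 100 * (real m + 5 / 4)"
  using assms(2)
proof
  assume "m = K - 1"
  then have K: "K = Suc m" using assms(1) by simp
  have "real K * (real K / (real K - 1)) ^ m = (real m + 1) * (real (Suc m) / real m) ^ m"
    unfolding K by (simp add: add.commute)
  also have "\<dots> \<le> (real m + 1) * (272 / 100)"
    using one_plus_inverse_power_le[of m] assms(1) by (intro mult_left_mono) auto
  finally show ?thesis by simp
next
  assume "m = K"
  define k where "k = m - 1"
  have K: "K = Suc k" "m = Suc k" "4 \<le> k" using \<open>m = K\<close> assms(1) unfolding k_def by auto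
  have "real K * (real K / (real K - 1)) ^ m
      = (real (Suc k) * (real (Suc k) / real k)) * (real (Suc k) / real k) ^ k"
    unfolding K by (simp add: add.commute)
  also have "\<dots> \<le> (real (Suc k) * (real (Suc k) / real k)) * (272 / 100)"
    using one_plus_inverse_power_le[of k] K by (intro mult_left_mono) auto
  also have "real (Suc k) * (real (Suc k) / real k) \<le> real m + 5 / 4"
    using K by (simp add: field_simps)
  finally show ?thesis by simp
qed

text \<open>\<open>V\<close> is the product of the inverse rounded values over a star with
  \<open>m\<close> partners. A linear bound on \<open>V\<close> settles \<open>5 \<le> m\<close>;
  five small cases are computed separately.\<close>

lemma star_weight_bounds:
  fixes c :: real
  assumes c: "c = (3 * log 2 3 - 2) / log 2 3" "33 / 19 \<le> c"
    and "3 \<le> K" "m = K - 1 \<or> m = K"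
  defines "V \<equiv> real K * (real K / (real K - 1)) ^ m"
  shows "V powr (1 / c) \<le> real m + 1" "(4 * V) powr (1 / c) \<le> 2 * real m + 3"
    "(16 * V) powr (1 / c) \<le> 4 * real m + 8"
proof -
  have Vpos: "0 < V" unfolding V_def using assms(3) by simp
  consider (a) "K = 3" "m = 2" | (b) "K = 3" "m = 3" | (c) "K = 4" "m = 3" | (d) "K = 4" "m = 4"
    | (e) "K = 5" "m = 4" | (f) "5 \<le> m" using assms(3,4) by linarith
  then have "V powr (1 / c) \<le> real m + 1 \<and> (4 * V) powr (1 / c) \<le> 2 * real m + 3
    \<and> (16 * V) powr (1 / c) \<le> 4 * real m + 8"
  proof cases
    case a
    have V: "V = 27 / 4" unfolding V_def a by (simp add: power2_eq_square)
    \<comment> \<open>The tight case: \<open>c\<close> is the exponent for which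
      \<open>V = 27 / 4\<close> gives exactly \<open>V powr (1 / c) = 3 = m + 1\<close>.\<close>
    have "log 2 V = 3 * log 2 3 - 2"
    proof -
      have "log 2 V = log 2 (3 ^ 3 / 2 ^ 2)" unfolding V by simp
      also have "\<dots> = log 2 (3 ^ 3) - log 2 (2 ^ 2)" by (intro log_divide_pos) auto
      also have "\<dots> = 3 * log 2 3 - 2" by (subst (1 2) log_nat_power) auto
      finally show ?thesis .
    qed
    then have "log 2 V = c * log 2 3" using c log_2_3_ge by simp
    then have "V powr (1 / c) = 3"
    proof -
      have "ln V = c * ln 3" using \<open>log 2 V = c * log 2 3\<close> by (simp add: log_def field_simps)
      then show ?thesis unfolding powr_def using Vpos assms(2) by simp
    qed
    moreover have "(4 * V) powr (1 / c) \<le> 7" "(16 * V) powr (1 / c) \<le> 16"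
      unfolding V by (intro powr_inverse_le[OF c(2)]; simp add: power_divide)+
    ultimately show ?thesis using a by simp
  next
    case b
    have V: "V = 81 / 8" unfolding V_def b by (simp add: power3_eq_cube)
    have "V powr (1 / c) \<le> 4" "(4 * V) powr (1 / c) \<le> 9" "(16 * V) powr (1 / c) \<le> 20"
      unfolding V by (intro powr_inverse_le[OF c(2)]; simp add: power_divide)+
    then show ?thesis using b by simp
  next
    case c
    have V: "V = 256 / 27" unfolding V_def c by (simp add: power3_eq_cube)
    have "V powr (1 / c) \<le> 4" "(4 * V) powr (1 / c) \<le> 9" "(16 * V) powr (1 / c) \<le> 20"
      unfolding V by (intro powr_inverse_le[OF assms(2)]; simp add: power_divide)+
    then show ?thesis using c by simp
  next
    case d
    have V: "V = 1024 / 81" unfolding V_def d by (simp add: power4_eq_xxxx)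
    have "V powr (1 / c) \<le> 5" "(4 * V) powr (1 / c) \<le> 11" "(16 * V) powr (1 / c) \<le> 24"
      unfolding V by (intro powr_inverse_le[OF c(2)]; simp add: power_divide)+
    then show ?thesis using d by simp
  next
    case e
    have V: "V = 3125 / 256" unfolding V_def e by (simp add: power4_eq_xxxx)
    have "V powr (1 / c) \<le> 5" "(4 * V) powr (1 / c) \<le> 11" "(16 * V) powr (1 / c) \<le> 24"
      unfolding V by (intro powr_inverse_le[OF c(2)]; simp add: power_divide)+
    then show ?thesis using e by simp
  next
    case f
    have V: "V \<le> 272 / 100 * (real m + 5 / 4)"
      unfolding V_def by (rule star_weight_large[OF f assms(4)])
    \<comment> \<open>Each value of \<open>q0\<close> below is the right-hand side at
      \<open>m = 5\<close>.\<close>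
    have "V powr (1 / c) \<le> real m + 1"
      using V Vpos f by (intro powr_inverse_le'[OF c(2), where d = 3 and ?q0.0 = 6]) auto
    moreover have "(4 * V) powr (1 / c) \<le> 2 * real m + 3"
      using V Vpos f by (intro powr_inverse_le'[OF c(2), where d = 6 and ?q0.0 = 13]) auto
    moreover have "(16 * V) powr (1 / c) \<le> 4 * real m + 8"
      using V Vpos f by (intro powr_inverse_le'[OF c(2), where d = 11 and ?q0.0 = 28]) auto
    ultimately show ?thesis by blast
  qed
  then show "V powr (1 / c) \<le> real m + 1" "(4 * V) powr (1 / c) \<le> 2 * real m + 3"
    "(16 * V) powr (1 / c) \<le> 4 * real m + 8" by blast+
qed

section \<open>Rounding to unit fractions and their complements\<close>

definition round_unit :: "real \<Rightarrow> real" where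
  "round_unit y = (if y \<le> 1 / 2 then 1 / of_int \<lfloor>1 / y\<rfloor>
    else if y < 1 then 1 - 1 / of_int \<lfloor>1 / (1 - y)\<rfloor> else 1)"

lemma floor_inverse_ge_2:
  fixes y :: real
  assumes "0 < y" "y \<le> 1 / 2"
  shows "2 \<le> \<lfloor>1 / y\<rfloor>"
  using assms by (simp add: le_floor_iff field_simps)

lemma floor_inverse_antimono:
  fixes u v :: real
  assumes "0 < u" "u \<le> v" "v \<le> 1 / 2"
  shows "1 / real_of_int \<lfloor>1 / u\<rfloor> \<le> 1 / real_of_int \<lfloor>1 / v\<rfloor>"
proof -
  have "1 / v \<le> 1 / u" using assms by (simp add: frac_le)
  then have "\<lfloor>1 / v\<rfloor> \<le> \<lfloor>1 / u\<rfloor>" by (rule floor_mono)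
  then show ?thesis using floor_inverse_ge_2[of v] assms by (intro divide_left_mono) auto
qed

lemma round_unit_half:
  assumes "0 < y" "y \<le> 1 / 2"
  shows "0 < round_unit y" "round_unit y \<le> 1 / 2"
proof -
  have "2 \<le> real_of_int \<lfloor>1 / y\<rfloor>" using floor_inverse_ge_2[OF assms] by linarith
  then show "0 < round_unit y" "round_unit y \<le> 1 / 2"
    using assms by (auto simp: round_unit_def field_simps)
qed

lemma round_unit_reflect:
  assumes "1 / 2 < y" "y < 1"
  shows "round_unit y = 1 - round_unit (1 - y)"
  using assms by (simp add: round_unit_def)

lemma round_unit_pos:
  assumes "0 < y"
  shows "0 < round_unit y"
proof -
  consider "y \<le> 1 / 2" | "1 / 2 < y" "y < 1" | "1 \<le> y" by linarith
  then show ?thesis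
  proof cases
    case 2
    then show ?thesis using round_unit_reflect[OF 2] round_unit_half(2)[of "1 - y"] by simp
  qed (use assms round_unit_half(1) in \<open>auto simp: round_unit_def\<close>)
qed

text \<open>If neither value exceeds \<open>1 / 2\<close>, neither do the rounded ones. If
  \<open>u \<le> 1 / 2 < v\<close>, then \<open>u \<le> 1 - v\<close>, and monotonicity below
  \<open>1 / 2\<close> together with the reflection
  \<open>round_unit v = 1 - round_unit (1 - v)\<close> carries the inequality over.\<close>

lemma round_unit_edge:
  assumes "0 < u" "0 < v" "u + v \<le> 1"
  shows "round_unit u + round_unit v \<le> 1"
proof -
  have *: "round_unit u + round_unit v \<le> 1"
    if "0 < u" "0 < v" "u + v \<le> 1" "u \<le> 1 / 2" for u v :: real
  proof (cases "v \<le> 1 / 2")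
    case True
    then show ?thesis using round_unit_half(2)[of u] round_unit_half(2)[of v] that by linarith
  next
    case False
    then have "round_unit v = 1 - round_unit (1 - v)" using that by (intro round_unit_reflect) auto
    moreover have "round_unit u \<le> round_unit (1 - v)"
      using floor_inverse_antimono[of u "1 - v"] that False by (simp add: round_unit_def)
    ultimately show ?thesis by simp
  qed
  show ?thesis using *[of u v] *[of v u] assms by (cases "u \<le> 1 / 2") (auto simp: add.commute)
qed

lemma round_unit_fraction:
  assumes "0 < y"
  obtains j k :: nat where "0 < k" "j \<le> k" "round_unit y = real j / real k"
proof -
  consider "y \<le> 1 / 2" | "1 / 2 < y" "y < 1" | "1 \<le> y" by linarith
  then show thesis
  proof cases
    case 1
    then have "2 \<le> \<lfloor>1 / y\<rfloor>" using assms floor_inverse_ge_2 by blast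
    then have "0 < nat \<lfloor>1 / y\<rfloor>" "real (nat \<lfloor>1 / y\<rfloor>) = of_int \<lfloor>1 / y\<rfloor>" by linarith+
    then show thesis using 1 by (intro that[of "nat \<lfloor>1 / y\<rfloor>" 1]) (simp_all add: round_unit_def Suc_le_eq)
  next
    case 2
    define k where "k = nat \<lfloor>1 / (1 - y)\<rfloor>"
    have "2 \<le> \<lfloor>1 / (1 - y)\<rfloor>" using 2 floor_inverse_ge_2[of "1 - y"] by simp
    then have k: "2 \<le> k" "of_int \<lfloor>1 / (1 - y)\<rfloor> = real k" unfolding k_def by linarith+
    have "round_unit y = 1 - 1 / real k" using 2 k(2) by (simp add: round_unit_def)
    also have "\<dots> = real (k - 1) / real k" using k(1) by (simp add: of_nat_diff field_simps)
    finally show thesis using k(1) by (intro that[of k "k - 1"]) auto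
  next
    case 3
    then show thesis using that[of 1 1] by (simp add: round_unit_def)
  qed
qed

text \<open>\<open>y\<close> is the average of \<open>n\<close> level sets, cut from below on
  \<open>C\<close> and from above on \<open>D\<close>. An edge inside a level set would give
  \<open>i < f u\<close> and \<open>n \<le> f v + i\<close>, against
  \<open>f u + f v \<le> n\<close>.\<close>

lemma bipartite_fraction_in_STAB:
  fixes y :: "'a \<Rightarrow> real" and f :: "'a \<Rightarrow> nat"
  assumes "stable_set V E C" "stable_set V E D" "V = C \<union> D" "C \<inter> D = {}" "sym E"
    and "0 < n" "\<And>v. v \<in> V \<Longrightarrow> f v \<le> n" "\<And>u v. (u, v) \<in> E \<Longrightarrow> f u + f v \<le> n"
    and "\<And>v. v \<in> V \<Longrightarrow> y v = real (f v) / real n" "\<And>v. v \<notin> V \<Longrightarrow> y v = 0"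
  shows "y \<in> STAB V E"
proof -
  define T where "T = (\<lambda>i. {u \<in> C. i < f u} \<union> {v \<in> D. n \<le> f v + i})"
  have stable: "stable_set V E (T i)" for i
  proof -
    have "(u, v) \<notin> E" if "u \<in> T i" "v \<in> T i" for u v
    proof
      assume uv: "(u, v) \<in> E"
      then have "(v, u) \<in> E" using assms(5) by (auto dest: symD)
      then show False
        using that uv assms(1,2) assms(8)[OF uv] assms(8)[of v u]
        unfolding T_def stable_set_def by fastforce
    qed
    moreover have "T i \<subseteq> V" using assms(3) unfolding T_def by blast
    ultimately show ?thesis unfolding stable_set_def by blast
  qed
  have "(\<Sum>i<n. (1 / real n) *\<^sub>R (indicator (T i) :: 'a \<Rightarrow> real)) \<in> STAB V E"
    unfolding STAB_def using assms(6) stable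
    by (intro convex_sum) (auto intro!: hull_inc)
  moreover have "(\<Sum>i<n. (1 / real n) *\<^sub>R (indicator (T i) :: 'a \<Rightarrow> real)) = y"
  proof
    fix v
    have "(\<Sum>i<n. (1 / real n) *\<^sub>R (indicator (T i) :: 'a \<Rightarrow> real)) v = real (card {i \<in> {..<n}. v \<in> T i}) / real n"
      by (simp add: sum_fun_apply indicator_def sum.If_cases flip: sum_divide_distrib)
         (simp add: Int_def conj_commute)
    also have "\<dots> = y v"
    proof (cases "v \<in> V")
      case False
      then have "v \<notin> T i" for i using assms(3) unfolding T_def by blast
      then show ?thesis using assms(10)[OF False] by simp
    next
      case True
      have "{i \<in> {..<n}. v \<in> T i} = (if v \<in> C then {..<f v} else {n - f v..<n})"
        using True assms(3,4) assms(7)[OF True] unfolding T_def by auto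
      then show ?thesis using assms(9)[OF True] assms(7)[OF True] by auto
    qed
    finally show "(\<Sum>i<n. (1 / real n) *\<^sub>R (indicator (T i) :: 'a \<Rightarrow> real)) v = y v" .
  qed
  ultimately show ?thesis by simp
qed

lemma common_denominator:
  fixes y :: "'a \<Rightarrow> real"
  assumes "finite V" "\<And>v. v \<in> V \<Longrightarrow> \<exists>j k :: nat. 0 < k \<and> y v = real j / real k"
  obtains n :: nat and f :: "'a \<Rightarrow> nat" where "0 < n" "\<And>v. v \<in> V \<Longrightarrow> y v = real (f v) / real n"
proof -
  obtain j k :: "'a \<Rightarrow> nat" where jk: "\<And>v. v \<in> V \<Longrightarrow> 0 < k v \<and> y v = real (j v) / real (k v)"
    using assms(2) by metis
  define n where "n = prod k V"
  have "0 < n" unfolding n_def using jk by (intro prod_pos) auto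
  moreover have "y v = real (j v * (n div k v)) / real n" if "v \<in> V" for v
  proof -
    have "k v dvd n" unfolding n_def using assms(1) that by (rule dvd_prodI)
    then show ?thesis using jk[OF that] \<open>0 < n\<close> by (simp add: real_of_nat_div field_simps)
  qed
  ultimately show thesis using that[of n "\<lambda>v. j v * (n div k v)"] by blast
qed

section \<open>Chains and a partition into two of them\<close>

lemma chain_has_maximum:
  assumes "finite A" "partial_order_on A r" "stable_set A (incomparability A r) C" "I \<subseteq> C" "I \<noteq> {}"
  shows "\<exists>m\<in>I. \<forall>p\<in>I. (p, m) \<in> r"
proof -
  obtain m where "minimal_in (r\<inverse>) I m"
    using exists_minimal_in[of A "r\<inverse>" I] assms by auto
  then have m: "m \<in> I" "\<And>p. p \<in> I \<Longrightarrow> (m, p) \<in> r \<Longrightarrow> p = m" unfolding minimal_in_def by auto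
  have "(p, m) \<in> r" if "p \<in> I" for p
  proof -
    have "p \<in> A" "m \<in> A" "(p, m) \<notin> incomparability A r"
      using that m(1) assms(3,4) unfolding stable_set_def by auto
    moreover have "(m, m) \<in> r"
      using partial_order_onD(1)[OF assms(2)] \<open>m \<in> A\<close> by (auto simp: refl_on_def)
    ultimately show ?thesis using m(2)[OF that] by (cases "p = m") (auto simp: incomparability_def)
  qed
  then show ?thesis using m(1) by blast
qed

text \<open>Galvin's proof of Dilworth's theorem, for width two.\<close>

lemma two_chain_partition:
  assumes "finite A" "partial_order_on A r"
    and no3: "\<And>u v w. (u, v) \<in> incomparability A r \<Longrightarrow> (v, w) \<in> incomparability A r
      \<Longrightarrow> (u, w) \<in> incomparability A r \<Longrightarrow> False"
    and "U \<subseteq> A"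
  shows "\<exists>C D. U = C \<union> D \<and> C \<inter> D = {} \<and> stable_set A (incomparability A r) C
    \<and> stable_set A (incomparability A r) D"
proof -
  let ?inc = "\<lambda>u v. (u, v) \<in> incomparability A r"
  have fin: "finite U" using assms(1,4) by (rule finite_subset[rotated])
  have tr: "(u, w) \<in> r" if "(u, v) \<in> r" "(v, w) \<in> r" for u v w
    using partial_order_onD(2)[OF assms(2)] that by (rule transD)
  have sym: "?inc v u" if "?inc u v" for u v using that by (auto simp: incomparability_def)
  have not_inc: "\<not> ?inc u v" if "(u, v) \<in> r \<or> (v, u) \<in> r" for u v
    using that by (auto simp: incomparability_def)
  show ?thesis
    using fin assms(4)
  proof (induction "card U" arbitrary: U rule: less_induct)
    case less
    show ?case
    proof (cases "U = {}")
      case True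
      then show ?thesis by (auto simp: stable_set_def)
    next
      case False
      then obtain a where "minimal_in (r\<inverse>) U a"
        using exists_minimal_in[of A "r\<inverse>" U] assms(1,2) by auto
      then have a: "a \<in> U" "\<And>p. p \<in> U \<Longrightarrow> (a, p) \<in> r \<Longrightarrow> p = a" unfolding minimal_in_def by auto
      define W where "W = U - {a}"
      have W: "W \<subseteq> A" "card W < card U" "finite W" "U = insert a W" "a \<notin> W"
        using less.prems a(1) card_Diff1_less[of U a] unfolding W_def by blast+
      obtain C D where CD: "W = C \<union> D" "C \<inter> D = {}" "stable_set A (incomparability A r) C"
        "stable_set A (incomparability A r) D"
        using less.hyps[OF W(2,3,1)] by blast
      \<comment> \<open>Elements of \<open>W\<close> outside \<open>I\<close> are comparable to all
        of \<open>W\<close>, so they do no harm in either chain.\<close>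
      define I where "I = {z \<in> W. \<exists>y\<in>W. ?inc z y}"
      have step: ?thesis
        if C: "W = C \<union> D" "C \<inter> D = {}" "stable_set A (incomparability A r) C"
          "stable_set A (incomparability A r) D" "\<And>p. p \<in> I \<inter> C \<Longrightarrow> (p, m) \<in> r" "(m, a) \<in> r" for C D m
      proof -
        \<comment> \<open>Any incomparable pair outside \<open>K\<close> would lie in
          \<open>I\<close> and have a member in \<open>C\<close>; that member is below
          \<open>m\<close> and hence in \<open>K\<close>.\<close>
        define K where "K = insert a {z \<in> C. (z, m) \<in> r}"
        have "stable_set A (incomparability A r) K"
        proof -
          have "\<not> ?inc p a" "\<not> ?inc a p" if "p \<in> K" for p
            using that tr[OF _ C(6)] not_inc unfolding K_def
            by (auto simp: incomparability_def)
          moreover have "\<not> ?inc p q" if "p \<in> C" "q \<in> C" for p q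
            using that C(3) unfolding stable_set_def by blast
          ultimately show ?thesis
            using W C(1) a(1) less.prems(2) unfolding stable_set_def K_def by blast
        qed
        moreover have "stable_set A (incomparability A r) (U - K)"
        proof -
          have "\<not> ?inc p q" if "p \<in> U - K" "q \<in> U - K" for p q
          proof
            assume pq: "?inc p q"
            then have "p \<in> I" "q \<in> I" using that sym W(4) unfolding I_def K_def by blast+
            moreover have "p \<in> C \<or> q \<in> C"
              using pq C(1,4) \<open>p \<in> I\<close> \<open>q \<in> I\<close> unfolding I_def stable_set_def by blast
            ultimately show False using C(5) that unfolding K_def by blast
          qed
          then show ?thesis using less.prems(2) unfolding stable_set_def by blast
        qed
        moreover have "U = K \<union> (U - K)" using C(1) W(4) unfolding K_def by blast
        ultimately show ?thesis by (metis Diff_disjoint)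
      qed
      show ?thesis
      proof (cases "I = {}")
        case True
        then have "stable_set A (incomparability A r) W"
          using W(1) unfolding I_def stable_set_def by blast
        moreover have "stable_set A (incomparability A r) {a}"
          using a(1) less.prems(2) by (auto simp: stable_set_def incomparability_def)
        moreover have "U = W \<union> {a}" "W \<inter> {a} = {}" using W by auto
        ultimately show ?thesis by blast
      next
        case False
        have other: "\<exists>y\<in>I \<inter> D. ?inc z y"
          if z: "z \<in> I" "z \<in> C" "W = C \<union> D" "stable_set A (incomparability A r) C" for z C D
        proof -
          obtain y where y: "y \<in> W" "?inc z y" using z(1) unfolding I_def by blast
          then have "y \<in> D" using z unfolding stable_set_def by blast
          then show ?thesis using y z(1) sym unfolding I_def by blast
        qed
        have DC: "W = D \<union> C" using CD(1) by blast
        have "I \<inter> C \<noteq> {}" "I \<inter> D \<noteq> {}"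
          using False other[OF _ _ CD(1,3)] other[OF _ _ DC CD(4)] CD(1) unfolding I_def by blast+
        then obtain m1 m2 where m: "m1 \<in> I \<inter> C" "\<forall>p\<in>I \<inter> C. (p, m1) \<in> r"
          "m2 \<in> I \<inter> D" "\<forall>p\<in>I \<inter> D. (p, m2) \<in> r"
          using chain_has_maximum[OF assms(1,2) CD(3) Int_lower2] chain_has_maximum[OF assms(1,2) CD(4) Int_lower2] by metis
        obtain y1 y2 where y: "y1 \<in> I \<inter> D" "?inc m1 y1" "y2 \<in> I \<inter> C" "?inc m2 y2"
          using other[OF _ _ CD(1,3)] other[OF _ _ DC CD(4)] m by blast
        have memA: "m1 \<in> A" "m2 \<in> A" "a \<in> A" "m1 \<in> U" "m2 \<in> U" "m1 \<noteq> a" "m2 \<noteq> a"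
          using m CD(1) W a less.prems by auto
        \<comment> \<open>\<open>m1\<close> below \<open>m2\<close> would put \<open>y2\<close>
          below \<open>m2\<close>, and \<open>m2\<close> below \<open>m1\<close> would put
          \<open>y1\<close> below \<open>m1\<close>. So the two maxima are incomparable, and by
          \<open>no3\<close> one of them lies below the maximal element \<open>a\<close>.\<close>
        have "(m1, m2) \<notin> r" "(m2, m1) \<notin> r" using y m tr not_inc by blast+
        moreover have "m1 \<noteq> m2" using m CD(2) by blast
        ultimately have "?inc m1 m2" using memA by (auto simp: incomparability_def)
        then have "\<not> (?inc m1 a \<and> ?inc m2 a)" using no3 by blast
        moreover have "(a, m1) \<notin> r" "(a, m2) \<notin> r" using a(2) memA by auto
        ultimately have "(m1, a) \<in> r \<or> (m2, a) \<in> r" using memA by (auto simp: incomparability_def)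
        then show ?thesis
          using step[OF CD _, of m1] step[OF DC _ CD(4,3), of m2] m CD(2) by blast
      qed
    qed
  qed
qed

section \<open>The layout of an optimal point\<close>

text \<open>First-order optimality: in the direction \<open>indicator S - x\<close> the derivative
  of the sum of logarithms is the weight of \<open>S\<close> minus \<open>card V\<close>. If it were
  positive, a small step towards \<open>S\<close> would improve on \<open>x\<close>.\<close>

lemma optimal_stable_weight:
  fixes x :: "'a \<Rightarrow> real"
  assumes "finite V" "x \<in> STAB V E" "\<And>v. v \<in> V \<Longrightarrow> 0 < x v"
    and opt: "\<And>y. y \<in> STAB V E \<Longrightarrow> (\<forall>v\<in>V. 0 < y v) \<Longrightarrow> (\<Sum>v\<in>V. ln (y v)) \<le> (\<Sum>v\<in>V. ln (x v))"
    and S: "stable_set V E S"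
  shows "(\<Sum>v\<in>S. 1 / x v) \<le> real (card V)"
proof (rule ccontr)
  assume neg: "\<not> ?thesis"
  define d where "d = (\<lambda>v. indicator S v - x v)"
  define f where "f = (\<lambda>h. \<Sum>v\<in>V. ln (x v + h * d v))"
  have "((\<lambda>h. ln (x v + h * d v)) has_real_derivative d v / x v) (at 0)" if "v \<in> V" for v
    using assms(3)[OF that] by (auto intro!: derivative_eq_intros)
  then have "(f has_real_derivative (\<Sum>v\<in>V. d v / x v)) (at 0)"
    unfolding f_def by (intro DERIV_sum)
  moreover have "0 < (\<Sum>v\<in>V. d v / x v)"
  proof -
    have "(\<Sum>v\<in>V. d v / x v) = (\<Sum>v\<in>V. indicator S v * (1 / x v) - 1)"
      using less_imp_neq[OF assms(3)] by (intro sum.cong refl) (fastforce simp: d_def diff_divide_distrib)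
    also have "\<dots> = (\<Sum>v\<in>V. indicator S v * (1 / x v)) - real (card V)"
      by (simp add: sum_subtractf)
    also have "(\<Sum>v\<in>V. indicator S v * (1 / x v)) = (\<Sum>v\<in>S. 1 / x v)"
      using S assms(1) unfolding stable_set_def
      by (intro sum.mono_neutral_cong_right) (auto simp: indicator_def)
    finally show ?thesis using neg by simp
  qed
  ultimately obtain \<delta> where \<delta>: "0 < \<delta>" "\<And>h. 0 < h \<Longrightarrow> h < \<delta> \<Longrightarrow> f 0 < f (0 + h)"
    using DERIV_pos_inc_right by blast
  define h where "h = min (\<delta> / 2) (1 / 2)"
  have h: "0 < h" "h < \<delta>" "h < 1" unfolding h_def using \<delta>(1) by auto
  define y where "y = (1 - h) *\<^sub>R x + h *\<^sub>R (indicator S :: 'a \<Rightarrow> real)"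
  have y: "y v = x v + h * d v" for v unfolding y_def d_def by (simp add: algebra_simps)
  have "indicator S \<in> STAB V E" unfolding STAB_def using S by (intro hull_inc) auto
  then have "y \<in> STAB V E"
    unfolding y_def using assms(2) h unfolding STAB_def by (intro convexD convex_convex_hull) auto
  moreover have "0 < y v" if "v \<in> V" for v
  proof -
    have "0 < (1 - h) * x v" using assms(3)[OF that] h by simp
    moreover have "0 \<le> h * (indicator S v :: real)" using h by simp
    ultimately show ?thesis unfolding y_def by simp
  qed
  ultimately have "f h \<le> f 0" using opt[of y] unfolding f_def by (simp add: y)
  then show False using \<delta>(2)[OF h(1,2)] by simp
qed

text \<open>Averaged with the coefficients \<open>u\<close>, the weights of the stable sets give the
  sum of \<open>x v / x v\<close>, that is \<open>card V\<close>. None exceeds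
  \<open>card V\<close>, so those with nonzero coefficient attain it.\<close>

lemma optimal_decomposition:
  assumes "finite_simple_graph V E"
  obtains x u :: "_ \<Rightarrow> real" where "\<And>v. v \<in> V \<Longrightarrow> 0 < x v"
    "\<And>S. stable_set V E S \<Longrightarrow> 0 \<le> u S" "sum u {S. stable_set V E S} = 1"
    "\<And>v. x v = (\<Sum>S | stable_set V E S. u S * indicator S v)"
    "\<And>S. stable_set V E S \<Longrightarrow> (\<Sum>v\<in>S. 1 / x v) \<le> real (card V)"
    "\<And>S. stable_set V E S \<Longrightarrow> u S \<noteq> 0 \<Longrightarrow> (\<Sum>v\<in>S. 1 / x v) = real (card V)"
proof -
  have fin: "finite V" using assms by (simp add: finite_simple_graph_def)
  let ?T = "{S. stable_set V E S}"
  have finT: "finite ?T" using fin by (rule finite_stable_sets)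
  obtain x where x: "x \<in> STAB V E" "\<forall>v\<in>V. x v > 0"
    "\<And>y. y\<in>STAB V E \<Longrightarrow> (\<forall>v\<in>V. y v > 0) \<Longrightarrow>
      - (1 / real (card V)) * (\<Sum>v\<in>V. log 2 (x v)) \<le> - (1 / real (card V)) * (\<Sum>v\<in>V. log 2 (y v))"
    using graph_entropy_minimizer[OF assms] by blast
  have opt: "(\<Sum>v\<in>V. ln (y v)) \<le> (\<Sum>v\<in>V. ln (x v))" if "y \<in> STAB V E" "\<forall>v\<in>V. 0 < y v" for y
  proof (cases "V = {}")
    case False
    then have "0 < real (card V)" using fin by (simp add: card_gt_0_iff)
    then have "(\<Sum>v\<in>V. log 2 (y v)) \<le> (\<Sum>v\<in>V. log 2 (x v))"
      using x(3)[OF that] by (simp add: divide_le_cancel)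
    then show ?thesis by (simp add: log_def divide_le_cancel flip: sum_divide_distrib)
  qed simp
  obtain u where u: "\<forall>S\<in>?T. 0 \<le> u S" "sum u ?T = 1" "x = (\<lambda>v. \<Sum>S\<in>?T. u S * indicator S v)"
    using x(1) unfolding STAB_eq[OF fin] by blast
  have le: "(\<Sum>v\<in>S. 1 / x v) \<le> real (card V)" if "stable_set V E S" for S
    using optimal_stable_weight[OF fin x(1) _ opt that] x(2) by blast
  have "(\<Sum>S\<in>?T. u S * (\<Sum>v\<in>S. 1 / x v)) = (\<Sum>S\<in>?T. \<Sum>v\<in>V. u S * indicator S v * (1 / x v))"
  proof (rule sum.cong[OF refl])
    fix S assume "S \<in> ?T"
    then have "(\<Sum>v\<in>S. 1 / x v) = (\<Sum>v\<in>V. indicator S v * (1 / x v))"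
      using fin unfolding stable_set_def
      by (intro sum.mono_neutral_cong_left) (auto simp: indicator_def)
    then show "u S * (\<Sum>v\<in>S. 1 / x v) = (\<Sum>v\<in>V. u S * indicator S v * (1 / x v))"
      by (simp add: sum_distrib_left mult.assoc)
  qed
  also have "\<dots> = (\<Sum>v\<in>V. \<Sum>S\<in>?T. u S * indicator S v * (1 / x v))" by (rule sum.swap)
  also have "\<dots> = (\<Sum>v\<in>V. x v * (1 / x v))"
    using u(3) by (simp only: sum_distrib_right[symmetric] fun_eq_iff)
  also have "\<dots> = (\<Sum>v\<in>V. 1)" using x(2) by (intro sum.cong) auto
  finally have total: "(\<Sum>S\<in>?T. u S * (real (card V) - (\<Sum>v\<in>S. 1 / x v))) = 0"
    using u(2) by (simp add: right_diff_distrib sum_subtractf flip: sum_distrib_right)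
  have tight: "(\<Sum>v\<in>S. 1 / x v) = real (card V)" if S: "stable_set V E S" "u S \<noteq> 0" for S
  proof -
    have "\<forall>S\<in>?T. u S * (real (card V) - (\<Sum>v\<in>S. 1 / x v)) = 0"
      using total by (subst (asm) sum_nonneg_eq_0_iff[OF finT]) (use u(1) le in auto)
    then show ?thesis using S by auto
  qed
  show thesis
    by (rule that[of x u]) (use x(2) u le tight in auto)
qed

text \<open>The intervals of a chain with nonzero coefficient tile the whole tape, so each point
  meets exactly one of its elements; averaging with \<open>u\<close> gives
  \<open>cover\<close>.\<close>

lemma tape_exists:
  fixes A :: "'a set"
  assumes fin: "finite A" and po: "partial_order_on A r"
    and no3: "\<And>u v w. (u, v) \<in> incomparability A r \<Longrightarrow> (v, w) \<in> incomparability A r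
      \<Longrightarrow> (u, w) \<in> incomparability A r \<Longrightarrow> False"
  obtains x s t where "tape A r x s t (real (card A))"
proof -
  let ?E = "incomparability A r"
  let ?T = "{S. stable_set A ?E S}"
  obtain x u :: "_ \<Rightarrow> real" where xu: "\<And>v. v \<in> A \<Longrightarrow> 0 < x v"
    "\<And>S. stable_set A ?E S \<Longrightarrow> 0 \<le> u S" "sum u ?T = 1"
    "\<And>v. x v = (\<Sum>S\<in>?T. u S * indicator S v)"
    "\<And>S. stable_set A ?E S \<Longrightarrow> (\<Sum>v\<in>S. 1 / x v) \<le> real (card A)"
    "\<And>S. stable_set A ?E S \<Longrightarrow> u S \<noteq> 0 \<Longrightarrow> (\<Sum>v\<in>S. 1 / x v) = real (card A)"
    using optimal_decomposition[OF finite_simple_graph_incomparability[OF fin]] by blast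
  have finT: "finite ?T" using fin by (rule finite_stable_sets)
  have tr: "(a, c) \<in> r" if "(a, b) \<in> r" "(b, c) \<in> r" for a b c
    using partial_order_onD(2)[OF po] that by (rule transD)
  have anti: "a = b" if "(a, b) \<in> r" "(b, a) \<in> r" for a b
    using partial_order_onD(3)[OF po] that by (rule antisymD)
  have rA: "a \<in> A" "b \<in> A" if "(a, b) \<in> r" for a b using partial_order_onD(4)[OF po] that by auto
  have rfl: "(a, a) \<in> r" if "a \<in> A" for a
    using partial_order_onD(1)[OF po] that by (auto simp: refl_on_def)
  have chain_iff: "stable_set A ?E S \<longleftrightarrow> S \<subseteq> A \<and> (\<forall>a\<in>S. \<forall>b\<in>S. (a, b) \<in> r \<or> (b, a) \<in> r)" for S
    unfolding stable_set_def incomparability_def using rfl by blast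
  define w where "w = (\<lambda>S. \<Sum>v\<in>S. 1 / x v)"
  have w_mono: "w S \<le> w S'" if "S \<subseteq> S'" "S' \<subseteq> A" for S S'
    unfolding w_def using that fin xu(1)
    by (intro sum_mono2) (auto intro: finite_subset less_imp_le)
  have w_Un: "w (S \<union> S') = w S + w S'" if "S \<subseteq> A" "S' \<subseteq> A" "S \<inter> S' = {}" for S S'
    unfolding w_def using that fin by (intro sum.union_disjoint) (auto intro: finite_subset)
  have w_insert: "w (insert v S) = 1 / x v + w S" if "S \<subseteq> A" "v \<notin> S" for v S
    unfolding w_def using that fin by (intro sum.insert) (auto intro: finite_subset)
  define below where "below = (\<lambda>v. {S. stable_set A ?E S \<and> (\<forall>u\<in>S. (u, v) \<in> r \<and> u \<noteq> v)})"
  define s where "s = (\<lambda>v. Max (w ` below v))"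
  define t where "t = (\<lambda>v. s v + 1 / x v)"
  have fin_below: "finite (w ` below v)" for v
    unfolding below_def using finT by (auto intro: finite_subset)
  have s_ge: "w S \<le> s v" if "S \<in> below v" for S v
    unfolding s_def using fin_below that by (intro Max_ge) auto
  have empty: "{} \<in> below v" for v unfolding below_def by (auto simp: chain_iff)
  have s_attained: "\<exists>S\<in>below v. s v = w S" for v
  proof -
    have "s v \<in> w ` below v" unfolding s_def using fin_below empty by (intro Max_in) auto
    then show ?thesis by blast
  qed
  have s_nonneg: "0 \<le> s v" for v using s_ge[OF empty, of v] by (simp add: w_def)
  have less: "t a \<le> s b" if ab: "(a, b) \<in> r" "a \<noteq> b" for a b
  proof -
    obtain S where S: "S \<in> below a" "s a = w S" using s_attained by blast
    have "insert a S \<in> below b"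
      using S(1) ab rA[OF ab(1)] rfl tr anti unfolding below_def chain_iff by blast
    moreover have "w (insert a S) = t a"
      using S unfolding below_def chain_iff t_def by (subst w_insert) auto
    ultimately show ?thesis using s_ge by metis
  qed
  have t_le: "t v \<le> real (card A)" if v: "v \<in> A" for v
  proof -
    obtain S where S: "S \<in> below v" "s v = w S" using s_attained by blast
    have "stable_set A ?E (insert v S)" using S(1) v rfl unfolding below_def chain_iff by blast
    then have "w (insert v S) \<le> real (card A)" unfolding w_def by (rule xu(5))
    moreover have "w (insert v S) = t v"
      using S unfolding below_def chain_iff t_def by (subst w_insert) auto
    ultimately show ?thesis by simp
  qed
  have one_active: "card {v \<in> S. s v \<le> \<tau> \<and> \<tau> < t v} = 1"
    if S: "stable_set A ?E S" "u S \<noteq> 0" and \<tau>: "0 \<le> \<tau>" "\<tau> < real (card A)" for S \<tau>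
  proof -
    have SA: "S \<subseteq> A" and tot: "\<And>a b. a \<in> S \<Longrightarrow> b \<in> S \<Longrightarrow> (a, b) \<in> r \<or> (b, a) \<in> r"
      using S(1) unfolding chain_iff by blast+
    have wS: "w S = real (card A)" unfolding w_def using S by (rule xu(6))
    \<comment> \<open>Exchange argument: replacing the part of \<open>S\<close> below
      \<open>v\<close> by a heavier chain below \<open>v\<close> would produce a chain of weight
      above \<open>card A\<close>.\<close>
    have t_tight: "w {u \<in> S. (u, v) \<in> r} = t v" if v: "v \<in> S" for v
    proof -
      define B where "B = {u \<in> S. (u, v) \<in> r \<and> u \<noteq> v}"
      define C where "C = {u \<in> S. (v, u) \<in> r \<and> u \<noteq> v}"
      have BC: "B \<subseteq> A" "C \<subseteq> A" "v \<notin> B" "v \<notin> C" "B \<inter> C = {}" "v \<in> A"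
        unfolding B_def C_def using SA v anti by blast+
      have "B \<in> below v" unfolding below_def chain_iff B_def using SA tot by blast
      then have "w B \<le> s v" by (rule s_ge)
      moreover have "s v \<le> w B"
      proof -
        obtain S' where S': "S' \<in> below v" "s v = w S'" using s_attained by blast
        have S'A: "S' \<subseteq> A" "v \<notin> S'" "S' \<inter> C = {}"
          using S'(1) anti unfolding below_def chain_iff C_def by blast+
        have "stable_set A ?E (S' \<union> insert v C)"
          unfolding chain_iff
        proof (intro conjI ballI)
          show "S' \<union> insert v C \<subseteq> A" using S'A BC by blast
        next
          fix a b assume "a \<in> S' \<union> insert v C" "b \<in> S' \<union> insert v C"
          moreover have "(p, q) \<in> r \<or> (q, p) \<in> r" if "p \<in> S'" "q \<in> S'" for p q
            using S'(1) that unfolding below_def chain_iff by blast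
          moreover have "(p, v) \<in> r" if "p \<in> S'" for p
            using S'(1) that unfolding below_def by blast
          moreover have "(v, p) \<in> r" "p \<in> S" if "p \<in> C" for p
            using that unfolding C_def by blast+
          ultimately show "(a, b) \<in> r \<or> (b, a) \<in> r"
            using tr tot rfl[OF BC(6)] by (metis Un_iff insert_iff)
        qed
        then have "w (S' \<union> insert v C) \<le> w S" unfolding wS unfolding w_def by (rule xu(5))
        moreover have "w (S' \<union> insert v C) = w S' + (1 / x v + w C)"
          using S'A BC by (subst w_Un) (auto simp: w_insert)
        moreover have "w S = w B + (1 / x v + w C)"
        proof -
          have "S = B \<union> insert v C" unfolding B_def C_def using tot v by blast
          then have "w S = w (B \<union> insert v C)" by simp
          also have "\<dots> = w B + (1 / x v + w C)"
            using BC by (subst w_Un) (auto simp: w_insert)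
          finally show ?thesis .
        qed
        ultimately show ?thesis using S'(2) by simp
      qed
      moreover have "{u \<in> S. (u, v) \<in> r} = insert v B" unfolding B_def using v rfl SA by blast
      ultimately show ?thesis using BC unfolding t_def by (simp add: w_insert)
    qed
    have max: "\<exists>m\<in>I. \<forall>p\<in>I. (p, m) \<in> r" if "I \<subseteq> S" "I \<noteq> {}" for I
      using chain_has_maximum[OF fin po S(1) that] .
    have "S \<noteq> {}" using wS \<tau> by (auto simp: w_def)
    then obtain m where m: "m \<in> S" "\<forall>p\<in>S. (p, m) \<in> r" using max[of S] by blast
    then have "{u \<in> S. (u, m) \<in> r} = S" by blast
    then have "\<tau> < t m" using t_tight[OF m(1)] wS \<tau>(2) by simp
    \<comment> \<open>The first element of \<open>S\<close> ending after \<open>\<tau>\<close>. It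
      starts at \<open>0\<close> or where its predecessor in \<open>S\<close> ends, hence not after
      \<open>\<tau>\<close>.\<close>
    then obtain v where "minimal_in r {v \<in> S. \<tau> < t v} v"
      using exists_minimal_in[OF fin po, of "{v \<in> S. \<tau> < t v}"] m(1) by blast
    then have v: "v \<in> S" "\<tau> < t v" "\<And>p. p \<in> S \<Longrightarrow> (p, v) \<in> r \<Longrightarrow> p \<noteq> v \<Longrightarrow> t p \<le> \<tau>"
      unfolding minimal_in_def by force+
    define B where "B = {p \<in> S. (p, v) \<in> r \<and> p \<noteq> v}"
    have "{p \<in> S. (p, v) \<in> r} = insert v B" unfolding B_def using v(1) rfl SA by blast
    then have sv: "s v = w B"
      using t_tight[OF v(1)] SA unfolding t_def B_def by (simp add: w_insert subset_iff)
    have "s v \<le> \<tau>"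
    proof (cases "B = {}")
      case True
      then show ?thesis using sv \<tau>(1) by (simp add: w_def)
    next
      case False
      then obtain p where p: "p \<in> B" "\<forall>q\<in>B. (q, p) \<in> r" using max[of B] unfolding B_def by blast
      then have "{q \<in> S. (q, p) \<in> r} = B" using tr anti unfolding B_def by blast
      then have "s v = t p" using t_tight[of p] p(1) sv unfolding B_def by simp
      then show ?thesis using v(3)[of p] p(1) unfolding B_def by simp
    qed
    moreover have "a = v" if "a \<in> S" "s a \<le> \<tau>" "\<tau> < t a" for a
    proof (rule ccontr)
      assume "a \<noteq> v"
      then have "t a \<le> s v \<or> t v \<le> s a" using tot[OF that(1) v(1)] less by metis
      then show False using that v(2) \<open>s v \<le> \<tau>\<close> by linarith
    qed
    ultimately have "{v \<in> S. s v \<le> \<tau> \<and> \<tau> < t v} = {v}" using v by blast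
    then show ?thesis by simp
  qed
  have "tape A r x s t (real (card A))"
  proof
    fix a b assume ab: "(a, b) \<in> ?E"
    have "x a + x b = (\<Sum>S\<in>?T. u S * (indicator S a + indicator S b))"
      unfolding xu(4) by (simp add: sum.distrib distrib_left)
    also have "\<dots> \<le> (\<Sum>S\<in>?T. u S * 1)"
      using ab xu(2) unfolding stable_set_def
      by (intro sum_mono mult_left_mono) (auto simp: indicator_def)
    finally show "x a + x b \<le> 1" using xu(3) by simp
  next
    fix \<tau> :: real assume \<tau>: "0 \<le> \<tau>" "\<tau> < real (card A)"
    let ?P = "{v. v \<in> A \<and> s v \<le> \<tau> \<and> \<tau> < t v}"
    have "(\<Sum>v\<in>?P. x v) = (\<Sum>v\<in>?P. \<Sum>S\<in>?T. u S * indicator S v)" by (simp add: xu(4))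
    also have "\<dots> = (\<Sum>S\<in>?T. \<Sum>v\<in>?P. u S * indicator S v)" by (rule sum.swap)
    also have "\<dots> = (\<Sum>S\<in>?T. u S)"
    proof (rule sum.cong[OF refl])
      fix S assume S: "S \<in> ?T"
      have "?P \<inter> S = {v \<in> S. s v \<le> \<tau> \<and> \<tau> < t v}" using S unfolding stable_set_def by blast
      moreover have "(\<Sum>v\<in>?P. indicator S v) = (\<Sum>v\<in>?P \<inter> S. 1 :: real)"
        using fin by (intro sum.mono_neutral_cong_right) (auto simp: indicator_def)
      ultimately have "(\<Sum>v\<in>?P. indicator S v) = real (card {v \<in> S. s v \<le> \<tau> \<and> \<tau> < t v})"
        by simp
      then show "(\<Sum>v\<in>?P. u S * indicator S v) = u S"
        using one_active[of S \<tau>] S \<tau> by (cases "u S = 0") (auto simp flip: sum_distrib_left)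
    qed
    finally show "(\<Sum>v\<in>?P. x v) = 1" using xu(3) by simp
  qed (use fin po no3 xu(1) s_nonneg t_le less in \<open>auto simp: t_def\<close>)
  then show thesis by (rule that)
qed

section \<open>Assembling the entropy bound\<close>

lemma powr_mult_power:
  fixes y z p :: real
  assumes "0 < y" "0 < z"
  shows "y powr p * (z powr p) ^ m = (y * z ^ m) powr p"
proof -
  have "(z powr p) ^ m = (z ^ m) powr p"
    using assms by (induction m) (auto simp: powr_mult)
  then show ?thesis using assms by (simp add: powr_mult)
qed

text \<open>Links \<open>iso\<close> to \<open>kappa2\<close>: no edge leaves such a pair, so it is
  a whole component.\<close>

lemma iso_component:
  assumes "(v, u) \<in> incomparability A r" "\<And>w. (v, w) \<in> incomparability A r \<Longrightarrow> w = u"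
    "\<And>w. (u, w) \<in> incomparability A r \<Longrightarrow> w = v"
  shows "{v, u} \<in> connected_components A (incomparability A r)" "card {v, u} = 2"
proof -
  let ?E = "incomparability A r"
  have mem: "v \<in> A" "u \<in> A" "v \<noteq> u" using assms(1) by (auto simp: incomparability_def)
  have "w = v \<or> w = u" if "(v, w) \<in> ?E\<^sup>*" for w
    using that by induction (use assms(2,3) in blast)+
  then have "{(p, q). p \<in> A \<and> q \<in> A \<and> (p, q) \<in> ?E\<^sup>*} `` {v} = {v, u}"
    using mem assms(1) by auto
  then show "{v, u} \<in> connected_components A ?E"
    unfolding connected_components_def
    using quotientI[OF mem(1), of "{(p, q). p \<in> A \<and> q \<in> A \<and> (p, q) \<in> ?E\<^sup>*}"] by simp
  show "card {v, u} = 2" using mem by simp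
qed

lemma width_2_no_antichain_3:
  assumes "finite A" "width A r = 2"
    and "(u, v) \<in> incomparability A r" "(v, w) \<in> incomparability A r" "(u, w) \<in> incomparability A r"
  shows False
proof -
  have "antichain A r {u, v, w}" "card {u, v, w} = 3"
    using assms(3-5) by (auto simp: antichain_def incomparability_def)
  then have "3 \<in> card ` {S. antichain A r S}" by force
  then have "3 \<le> width A r"
    unfolding width_def using finite_antichains[OF assms(1)] by (intro Max_ge) auto
  then show False using assms(2) by simp
qed

theorem theorem3:
  fixes A :: "'a set" and r :: "'a rel" and \<epsilon> :: real
  assumes "finite A"
    and "partial_order_on A r"
    and "width A r = 2"
    and "\<epsilon> = 2 - (3 * log 2 3 - 2) / log 2 3"
  shows "real (card A) * incomparability_entropy A r
    \<le> (2 - \<epsilon>) * log 2 (real (card (linear_extensions A r))) + \<epsilon> * real (kappa2 A r)"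
proof -
  let ?E = "incomparability A r"
  define c where "c = 2 - \<epsilon>"
  have c_eq: "c = (3 * log 2 3 - 2) / log 2 3" using assms(4) by (simp add: c_def)
  then have "c = 3 - 2 / log 2 3" using log_2_3_ge by (simp add: field_simps)
  moreover have "2 / log 2 3 \<le> 2 / (19 / 12 :: real)" using log_2_3_ge by (intro divide_left_mono) auto
  moreover have "log 2 (4 :: real) = 2" using log_nat_power[of 2 2 2] by simp
  then have "log 2 (3 :: real) \<le> 2" using log_mono[of 2 3 4] by simp
  then have "2 / 2 \<le> 2 / log 2 (3 :: real)" using log_2_3_ge by (intro divide_left_mono) auto
  ultimately have c: "33 / 19 \<le> c" "c \<le> 2" by auto
  have no3: False if "(u, v) \<in> ?E" "(v, w) \<in> ?E" "(u, w) \<in> ?E" for u v w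
    by (rule width_2_no_antichain_3[OF assms(1,3) that])
  obtain x s t where tape: "tape A r x s t (real (card A))"
    using tape_exists[OF assms(1,2)] no3 by metis
  interpret tape A r x s t "real (card A)" by (rule tape)
  define \<beta> where "\<beta> = 2 powr (1 / c)"
  define \<phi> where "\<phi> = (\<lambda>v. round_unit (x v))"
  \<comment> \<open>An isolated edge gets total weight \<open>2\<close>, its number of orders.
    Elsewhere \<open>c * log 2 (wt v)\<close> is the term of \<open>v\<close> in the entropy bound
    given by the rounded point.\<close>
  define wt where "wt = (\<lambda>v. if iso v then sqrt 2 else (1 / \<phi> v) powr (1 / c))"
  have \<phi>_pos: "0 < \<phi> v" if "v \<in> A" for v unfolding \<phi>_def using x_pos[OF that] by (rule round_unit_pos)
  interpret weighted_tape A r x s t "real (card A)" wt \<beta>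
  proof
    show "0 < wt v" if "v \<in> A" for v using \<phi>_pos[OF that] by (simp add: wt_def)
    show "wt v = 1" if "v \<in> A" "x v = 1" for v
      using that iso_half[of v] by (auto simp: wt_def \<phi>_def round_unit_def)
    show "wt v = sqrt 2" if "iso v" for v using that by (simp add: wt_def)
    show "wt v = \<beta>" if v: "v \<in> A" "\<not> iso v" "1 / 3 < x v" "x v < 2 / 3" for v
    proof -
      have two: "\<lfloor>1 / y\<rfloor> = 2" if "1 / 3 < y" "y \<le> 1 / 2" for y :: real
        using that by (intro floor_unique) (auto simp: field_simps)
      have half: "\<phi> v = 1 / 2"
        using two[of "x v"] two[of "1 - x v"] v by (auto simp: \<phi>_def round_unit_def)
      have "1 / \<phi> v = 2" unfolding half by simp
      then show ?thesis using v(2) unfolding wt_def \<beta>_def by simp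
    qed
    show "wt a = wt b" if "\<not> iso a" "\<not> iso b" "x a = x b" for a b
      using that by (simp add: wt_def \<phi>_def)
    show "1 \<le> \<beta>" unfolding \<beta>_def using c by (intro ge_one_powr_ge_zero) auto
    have "(2 ^ 6) powr (1 / c) \<le> (11 :: real)" by (rule powr_inverse_le[OF c(1)]) auto
    then show "\<beta>^6 \<le> 11"
      unfolding \<beta>_def using powr_mult_power[of 1 2 "1 / c" 6] by simp
    show "wt a * wt b ^ m \<le> real m + 1 \<and> \<beta>^2 * (wt a * wt b ^ m) \<le> 2 * real m + 3
        \<and> \<beta>^4 * (wt a * wt b ^ m) \<le> 4 * real m + 8"
      if ab: "a \<in> A" "b \<in> A" "x a \<le> 1 / 3" "x b = 1 - x a"
        and m: "1 / x a - 2 < real m" "real m < 1 / x a" for a b m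
    proof -
      define K where "K = nat \<lfloor>1 / x a\<rfloor>"
      have "3 \<le> 1 / x a" using x_pos[OF ab(1)] ab(3) by (simp add: field_simps)
      then have "3 \<le> \<lfloor>1 / x a\<rfloor>" by (simp add: le_floor_iff)
      then have K: "3 \<le> K" "real_of_int \<lfloor>1 / x a\<rfloor> = real K" unfolding K_def by linarith+
      then have "real K \<le> 1 / x a" "1 / x a < real K + 1"
        using floor_correct[of "1 / x a"] by linarith+
      \<comment> \<open>\<open>1 / x a\<close> lies in \<open>[K, K + 1)\<close>, so
        \<open>m\<close> lies strictly between \<open>K - 2\<close> and
        \<open>K + 1\<close>.\<close>
      then have mK: "m = K - 1 \<or> m = K" using m K(1) by linarith
      have "\<not> iso a" "\<not> iso b" using iso_half[of a] iso_half[of b] ab(3,4) by auto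
      moreover have \<phi>a: "\<phi> a = 1 / real K" using ab(3) K by (simp add: \<phi>_def round_unit_def)
      moreover have \<phi>b: "\<phi> b = 1 - 1 / real K"
        using ab x_pos[OF ab(1)] K by (simp add: \<phi>_def round_unit_def)
      moreover have "1 / \<phi> a = real K" "1 / \<phi> b = real K / (real K - 1)"
        unfolding \<phi>a \<phi>b using K(1) by (simp_all add: field_simps)
      ultimately have wt: "wt a = real K powr (1 / c)" "wt b = (real K / (real K - 1)) powr (1 / c)"
        unfolding wt_def by metis+
      define V where "V = real K * (real K / (real K - 1)) ^ m"
      have Vpos: "0 < V" unfolding V_def using K(1) by simp
      have P: "wt a * wt b ^ m = V powr (1 / c)"
        unfolding wt V_def using K(1) by (intro powr_mult_power) auto
      have "\<beta>^2 = 4 powr (1 / c)" "\<beta>^4 = 16 powr (1 / c)"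
        unfolding \<beta>_def using powr_mult_power[of 1 2 "1 / c" 2] powr_mult_power[of 1 2 "1 / c" 4] by simp_all
      then have "\<beta>^2 * V powr (1 / c) = (4 * V) powr (1 / c)" "\<beta>^4 * V powr (1 / c) = (16 * V) powr (1 / c)"
        using Vpos by (simp_all add: powr_mult)
      then show ?thesis
        unfolding P using star_weight_bounds[OF c_eq c(1) K(1) mK] unfolding V_def by simp
    qed
  qed
  define e where "e = real (card (linear_extensions A r))"
  have "Restr r A = r" using partial_order_onD(4)[OF assms(2)] by blast
  then have prod: "prod wt A \<le> e" using prod_wt_le unfolding ext_count_def e_def by simp
  define I where "I = {v \<in> A. iso v}"
  \<comment> \<open>An isolated element yields \<open>c / 2 = 1 - \<epsilon> / 2\<close> instead of
    the \<open>1\<close> required; the deficit is charged to \<open>kappa2\<close>.\<close>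
  have log_wt: "c * log 2 (wt v) = - log 2 (\<phi> v) - (if iso v then \<epsilon> / 2 else 0)" if "v \<in> A" for v
  proof (cases "iso v")
    case True
    have half: "\<phi> v = 1 / 2" unfolding \<phi>_def iso_half[OF True] by (simp add: round_unit_def)
    have lw: "log 2 (wt v) = 1 / 2" using True by (simp add: wt_def log_def ln_sqrt)
    have l\<phi>: "log 2 (\<phi> v) = - 1" unfolding half by (simp add: log_divide)
    show ?thesis unfolding lw l\<phi> c_def using True by (simp add: field_simps)
  next
    case False
    then show ?thesis using \<phi>_pos[OF that] c(1) by (simp add: wt_def log_powr log_divide)
  qed
  have "c * log 2 (prod wt A) = (\<Sum>v\<in>A. c * log 2 (wt v))"
  proof -
    have "ln (prod wt A) = (\<Sum>v\<in>A. ln (wt v))" by (intro ln_prod assms(1)) (use wt_pos in force)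
    then show ?thesis by (simp add: log_def sum_divide_distrib sum_distrib_left)
  qed
  also have "\<dots> = (\<Sum>v\<in>A. - log 2 (\<phi> v) - (if iso v then \<epsilon> / 2 else 0))"
    using log_wt by (intro sum.cong) auto
  also have "\<dots> = (\<Sum>v\<in>A. - log 2 (\<phi> v)) - \<epsilon> / 2 * real (card I)"
    unfolding sum_subtractf I_def using assms(1) by (simp add: sum.If_cases Int_def)
  finally have sum_eq: "c * log 2 (prod wt A) = (\<Sum>v\<in>A. - log 2 (\<phi> v)) - \<epsilon> / 2 * real (card I)" .
  have "0 < prod wt A" using wt_pos by (intro prod_pos) auto
  then have "log 2 (prod wt A) \<le> log 2 e" using prod by simp
  then have "c * log 2 (prod wt A) \<le> c * log 2 e" using c(1) by (intro mult_left_mono) auto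
  then have bound: "(\<Sum>v\<in>A. - log 2 (\<phi> v)) \<le> c * log 2 e + \<epsilon> / 2 * real (card I)"
    using sum_eq by linarith
  \<comment> \<open>An upper bound suffices because \<open>c \<le> 2\<close> makes
    \<open>\<epsilon>\<close> nonnegative.\<close>
  have "card I \<le> 2 * kappa2 A r"
  proof -
    let ?C = "{C \<in> connected_components A ?E. card C = 2}"
    have "I \<subseteq> \<Union> ?C"
    proof
      fix v assume "v \<in> I"
      then obtain u where "inc v u" "\<And>w. inc v w \<Longrightarrow> w = u" "\<And>w. inc u w \<Longrightarrow> w = v"
        unfolding I_def iso_def by blast
      from iso_component[OF this] show "v \<in> \<Union> ?C" by blast
    qed
    moreover have finC: "finite ?C" using finite_connected_components[OF assms(1)] by simp
    moreover have "finite (\<Union> ?C)" using finC by (rule finite_Union) (auto intro: card_ge_0_finite)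
    ultimately have "card I \<le> card (\<Union> ?C)" by (intro card_mono)
    also have "\<dots> \<le> (\<Sum>C\<in>?C. card C)" by (rule card_Union_le_sum_card)
    also have "\<dots> = 2 * kappa2 A r" unfolding kappa2_def by simp
    finally show ?thesis .
  qed
  then have "\<epsilon> / 2 * real (card I) \<le> \<epsilon> / 2 * real (2 * kappa2 A r)"
    using c(2) c_def by (intro mult_left_mono) auto
  with bound have bound': "(\<Sum>v\<in>A. - log 2 (\<phi> v)) \<le> c * log 2 e + \<epsilon> * real (kappa2 A r)" by simp
  \<comment> \<open>Points of \<open>STAB\<close> vanish off the vertex set, hence the value
    \<open>0\<close> there.\<close>
  define y where "y = (\<lambda>v. if v \<in> A then \<phi> v else 0)"
  have "y \<in> STAB A ?E"
  proof -
    obtain C D where CD: "A = C \<union> D" "C \<inter> D = {}" "stable_set A ?E C" "stable_set A ?E D"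
      using two_chain_partition[OF assms(1,2) _ subset_refl] no3 by metis
    have "\<exists>j k :: nat. 0 < k \<and> y v = real j / real k" if "v \<in> A" for v
      using round_unit_fraction[OF x_pos[OF that]] that unfolding y_def \<phi>_def by metis
    then obtain n f where f: "0 < n" "\<And>v. v \<in> A \<Longrightarrow> y v = real (f v) / real n"
      using common_denominator[OF assms(1)] by metis
    have "f v \<le> n" if "v \<in> A" for v
    proof -
      have "\<phi> v \<le> 1"
        using round_unit_fraction[OF x_pos[OF that]] unfolding \<phi>_def by (metis divide_le_eq_1_pos of_nat_0_less_iff of_nat_mono)
      then show ?thesis using f(2)[OF that] f(1) that by (simp add: y_def)
    qed
    moreover have "f u + f v \<le> n" if uv: "(u, v) \<in> ?E" for u v
    proof -
      have "u \<in> A" "v \<in> A" using uv inc_mem by auto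
      then have "y u + y v \<le> 1"
        using round_unit_edge[OF x_pos x_pos inc_x[OF uv]] by (simp add: y_def \<phi>_def)
      then have "real (f u) + real (f v) \<le> real n"
        using f \<open>u \<in> A\<close> \<open>v \<in> A\<close> by (simp add: field_simps)
      then show ?thesis by linarith
    qed
    moreover have "sym ?E" by (auto simp: sym_def incomparability_def)
    ultimately show ?thesis
      using f CD by (intro bipartite_fraction_in_STAB[where f = f and n = n]) (auto simp: y_def)
  qed
  then have "incomparability_entropy A r \<le> - (1 / real (card A)) * (\<Sum>v\<in>A. log 2 (y v))"
    unfolding incomparability_entropy_def using \<phi>_pos
    by (intro graph_entropy_le[OF finite_simple_graph_incomparability[OF assms(1)]]) (auto simp: y_def)
  then have "real (card A) * incomparability_entropy A r
      \<le> real (card A) * (- (1 / real (card A)) * (\<Sum>v\<in>A. log 2 (y v)))"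
    by (intro mult_left_mono) auto
  also have "\<dots> = (\<Sum>v\<in>A. - log 2 (\<phi> v))"
    using assms(1) by (cases "A = {}") (auto simp: y_def sum_negf)
  finally show ?thesis using bound' unfolding c_def e_def by linarith
qed

end
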